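(* For each stationary point process $(\Phi,\mathbb P)$ on $\mathbb R^d$ with finite and positive intensity and each (flow-adapted) point-shift $F$, there exists a (flow-adapted) point-shift $F_\bot$ which is an $\mathcal L^F$-dense element of the $\mathcal L^F$-stable group, i.e. such that $\mathbb P$-almost surely $F_\bot$ is a bijection of $\Phi$, maps each $F$-foil onto itself, and for all $x\in\Phi$ $$\{F_\bot^i(x): i\in\mathbb Z\}=L^F(x).$$ In addition, $F_\bot$ can be chosen such that, almost surely, on each connected component of $G^F(\Phi)$ all of whose foils are infinite, the order $\preceq_{F_\bot}$ is preserved by $F$: $x\preceq_{F_\bot}y\Rightarrow F_\Phi(x)\preceq_{F_\bot}F_\Phi(y)$ for $x,y$ in the same foil. There is no uniqueness of such $F_\bot$ in general.
   Context: $\mathbf N$ is the space of locally finite simple counting measures on $\mathbb R^d$ with the $\sigma$-field generated by $\phi\mapsto\phi(B)$, $B$ Borel; $\phi\in\mathbf N$ is identified with its support. $\mathbf N^0\subset\mathbf N$ is the set of $\phi$ with an atom at $0$. The translation flow is $(\theta_t\phi)(B)=\phi(B+t)$ and $\theta_t x=x-t$. The group $\mathbb R^d$ also acts on the probability space by $\theta_t$; a stationary point process is a pair $(\Phi,\mathbb P)$ where $\mathbb P$ is invariant under all $\theta_t$ and $\Phi:\Omega\to\mathbf N$ is measurable with $\Phi(\theta_t\omega)=\theta_t\Phi(\omega)$. A point-map is a measurable $f:\mathbf N^0\to\mathbb R^d$ with $f(\phi)\in\phi$; the associated (flow-adapted) point-shift is $F_\phi(x)=f(\theta_x\phi)+x$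 for $\phi\in\mathbf N$, $x\in\phi$. All point-shifts are of this form. $G^F(\phi)$ is the graph with vertex set $\phi$ and an edge $(x,F_\phi(x))$ for each $x\in\phi$; the connected component of $x$ is the set of $y\in\phi$ with $F_\phi^m(x)=F_\phi^n(y)$ for some $m,n\ge 0$. The foil $L^F(x)$ is the class of $x$ for the equivalence relation $x\sim_F y\iff\exists n\in\mathbb N,\ F_\phi^n(x)=F_\phi^n(y)$. Almost surely, each component has either only finite foils or only infinite foils. The $\mathcal L^F$-stable group is the group, under composition, of all point-shifts $H$ which are bijective on $\Phi$ and preserve each foil ($H(L)=L$ for each foil $L$). Such an $H$ is $\mathcal L^F$-dense if the orbit $\{H^i(x):i\in\mathbb Z\}$ equals $L^F(x)$ for all $x$. For dense $H$, on an infinite foil, $\preceq_H$ is the total order generated by $x\preceq_H H(x)$, i.e. $x\preceq_H y$ iff $y=H^i(x)$ for some $i\ge0$. *)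

theory Defs
  imports "HOL-Probability.Probability"
begin

text \<open>A locally finite simple counting measure is represented by its support.\<close>

definition locally_finite_config :: "'a::euclidean_space set \<Rightarrow> bool" where
  "locally_finite_config \<phi> \<longleftrightarrow> (\<forall>B. bounded B \<longrightarrow> finite (\<phi> \<inter> B))"

definition num_points :: "'a set \<Rightarrow> 'a set \<Rightarrow> ennreal" where
  "num_points \<phi> B = emeasure (count_space UNIV) (\<phi> \<inter> B)"

text \<open>The measurable space \<open>\<^bold>N\<close>: the sigma-field is generated by all evaluations
  \<open>\<phi> \<mapsto> \<phi>(B)\<close>, with values in \<open>[0, \<infinity>]\<close>, for Borel sets \<open>B\<close> (bounded or not).\<close>

definition configs :: "'a::euclidean_space set measure" where
  "configs = sigma {\<phi>. locally_finite_config \<phi>}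
     {{\<phi>. locally_finite_config \<phi> \<and> num_points \<phi> B \<in> A} | B A.
        B \<in> sets borel \<and> A \<in> sets borel}"

definition configs0 :: "'a::euclidean_space set measure" where
  "configs0 = restrict_space configs {\<phi>. 0 \<in> \<phi>}"

definition translate :: "'a::euclidean_space \<Rightarrow> 'a set \<Rightarrow> 'a set" where
  "translate t \<phi> = (\<lambda>x. x - t) ` \<phi>"

text \<open>In terms of counting measures this is \<open>(\<theta>\<^sub>t \<phi>)(B) = \<phi>(B + t)\<close>.\<close>

lemma num_points_translate: "num_points (translate t \<phi>) B = num_points \<phi> ((\<lambda>x. x + t) ` B)"
proof -
  have eq: "translate t \<phi> \<inter> B = (\<lambda>x. x - t) ` (\<phi> \<inter> (\<lambda>x. x + t) ` B)"
    unfolding translate_def by force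
  have inj: "inj_on (\<lambda>x. x - t) A" for A
    by (simp add: inj_on_def)
  show ?thesis
    unfolding num_points_def eq
    by (cases "finite (\<phi> \<inter> (\<lambda>x. x + t) ` B)")
      (auto simp: emeasure_count_space finite_image_iff[OF inj] card_image[OF inj])
qed

text \<open>No joint measurability of the flow in \<open>(t, \<omega>)\<close> is required.\<close>

locale stationary_point_process = prob_space M for M :: "'w measure" +
  fixes \<theta> :: "'a::euclidean_space \<Rightarrow> 'w \<Rightarrow> 'w" and \<Phi> :: "'w \<Rightarrow> 'a set"
  assumes flow_measurable: "\<And>t. \<theta> t \<in> measurable M M"
    and flow_zero: "\<And>\<omega>. \<omega> \<in> space M \<Longrightarrow> \<theta> 0 \<omega> = \<omega>"
    and flow_add: "\<And>s t \<omega>. \<omega> \<in> space M \<Longrightarrow> \<theta> (s + t) \<omega> = \<theta> s (\<theta> t \<omega>)"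
    and flow_invariant: "\<And>t. distr M M (\<theta> t) = M"
    and process_measurable: "\<Phi> \<in> measurable M configs"
    and process_equivariant:
      "\<And>t \<omega>. \<omega> \<in> space M \<Longrightarrow> \<Phi> (\<theta> t \<omega>) = translate t (\<Phi> \<omega>)"

text \<open>Mean number of points in the unit cube \<open>[0,1]\<^sup>d\<close>.\<close>

definition intensity :: "'w measure \<Rightarrow> ('w \<Rightarrow> 'a::euclidean_space set) \<Rightarrow> ennreal" where
  "intensity M \<Phi> = (\<integral>\<^sup>+\<omega>. num_points (\<Phi> \<omega>) (cbox 0 One) \<partial>M)"

definition point_map :: "('a::euclidean_space set \<Rightarrow> 'a) \<Rightarrow> bool" where
  "point_map f \<longleftrightarrow> f \<in> measurable configs0 borel \<and> (\<forall>\<phi>\<in>space configs0. f \<phi> \<in> \<phi>)"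

text \<open>Every flow-adapted point-shift comes from a point-map \<open>f\<close>, and is therefore
  represented by it. The value \<open>point_shift f \<phi> x\<close> is only meaningful for \<open>x \<in> \<phi>\<close>.\<close>

definition point_shift :: "('a::euclidean_space set \<Rightarrow> 'a) \<Rightarrow> 'a set \<Rightarrow> 'a \<Rightarrow> 'a" where
  "point_shift f \<phi> x = f (translate x \<phi>) + x"

definition shift_component ::
    "('a::euclidean_space set \<Rightarrow> 'a) \<Rightarrow> 'a set \<Rightarrow> 'a \<Rightarrow> 'a set" where
  "shift_component f \<phi> x =
     {y \<in> \<phi>. \<exists>m n. (point_shift f \<phi> ^^ m) x = (point_shift f \<phi> ^^ n) y}"

definition foil :: "('a::euclidean_space set \<Rightarrow> 'a) \<Rightarrow> 'a set \<Rightarrow> 'a \<Rightarrow> 'a set" where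
  "foil f \<phi> x = {y \<in> \<phi>. \<exists>n. (point_shift f \<phi> ^^ n) x = (point_shift f \<phi> ^^ n) y}"

text \<open>Integer iterates of a self-map \<open>H\<close>, bijective on \<open>A\<close>.\<close>

definition int_iterate :: "'a set \<Rightarrow> ('a \<Rightarrow> 'a) \<Rightarrow> int \<Rightarrow> 'a \<Rightarrow> 'a" where
  "int_iterate A H i = (if 0 \<le> i then H ^^ nat i else inv_into A H ^^ nat (- i))"

text \<open>In the following, \<open>f\<close> and \<open>h\<close> are the point-maps of the point-shifts \<open>F\<close> and \<open>H\<close>.\<close>

definition foil_stable ::
    "('a::euclidean_space set \<Rightarrow> 'a) \<Rightarrow> ('a set \<Rightarrow> 'a) \<Rightarrow> 'a set \<Rightarrow> bool" where
  "foil_stable f h \<phi> \<longleftrightarrow>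
     bij_betw (point_shift h \<phi>) \<phi> \<phi> \<and>
     (\<forall>x\<in>\<phi>. point_shift h \<phi> ` foil f \<phi> x = foil f \<phi> x)"

definition foil_dense ::
    "('a::euclidean_space set \<Rightarrow> 'a) \<Rightarrow> ('a set \<Rightarrow> 'a) \<Rightarrow> 'a set \<Rightarrow> bool" where
  "foil_dense f h \<phi> \<longleftrightarrow>
     (\<forall>x\<in>\<phi>. {int_iterate \<phi> (point_shift h \<phi>) i x | i. True} = foil f \<phi> x)"

definition shift_le ::
    "('a::euclidean_space set \<Rightarrow> 'a) \<Rightarrow> 'a set \<Rightarrow> 'a \<Rightarrow> 'a \<Rightarrow> bool" where
  "shift_le h \<phi> x y \<longleftrightarrow> (\<exists>i::nat. y = (point_shift h \<phi> ^^ i) x)"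

definition foil_order_preserving ::
    "('a::euclidean_space set \<Rightarrow> 'a) \<Rightarrow> ('a set \<Rightarrow> 'a) \<Rightarrow> 'a set \<Rightarrow> bool" where
  "foil_order_preserving f h \<phi> \<longleftrightarrow>
     (\<forall>c\<in>\<phi>. (\<forall>z\<in>shift_component f \<phi> c. infinite (foil f \<phi> z)) \<longrightarrow>
        (\<forall>x\<in>shift_component f \<phi> c. \<forall>y\<in>foil f \<phi> x.
           shift_le h \<phi> x y \<longrightarrow>
           shift_le h \<phi> (point_shift f \<phi> x) (point_shift f \<phi> y)))"

end

theory Submission
  imports Defs
begin

text \<open>Write \<open>F\<close> for the point-shift of \<open>f\<close>. Two distinct points \<open>x\<close>, \<open>y\<close> of one foil have a last pair of
  distinct iterates \<open>F\<^sup>n x \<noteq> F\<^sup>n y\<close>, and then \<open>F\<^sup>n\<^sup>+\<^sup>1 x = F\<^sup>n\<^sup>+\<^sup>1 y\<close>. Comparing these two siblings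
  lexicographically orders the foil totally. The order commutes with translations, because the
  lexicographic order does, and \<open>F\<close> preserves it, because \<open>F x\<close> and \<open>F y\<close> are compared through the
  same siblings (\<open>foil_less_shift\<close>). The wanted shift sends each point to its immediate successor in
  its foil, and the greatest point, if there is one, to the least.

  This successor exists, and generates the whole foil, as soon as all order intervals are finite and
  every infinite foil has neither a least nor a greatest point, so that its order type is that of
  the integers. Both hold almost surely, by mass transport. Let \<open>R\<close> be a translation invariant
  relation under which each point has at most one target. In the mean, the number of pairs with
  source in the unit cube equals the number of pairs with target in the unit cube, by stationarity;
  the former mean is at most the intensity, so almost surely every point is the target of only
  finitely many points (\<open>AE_finite_fibres\<close>). For \<open>R x y\<close> given by \<open>F\<^sup>n x = y\<close> this makes the order
  intervals finite: if \<open>F\<^sup>n x = F\<^sup>n y\<close>, then \<open>F\<^sup>n\<close> maps whatever lies between \<open>x\<close> and \<open>y\<close> to the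
  same point. For \<open>R x y\<close> saying that \<open>y\<close> is the least (or the greatest) point of the foil of \<open>x\<close>,
  it says that a foil with an endpoint is finite.

  The successor must also be a measurable function of the configuration. A locally finite
  configuration can be enumerated measurably through the members of a countable base that contain
  exactly one of its points, so that quantifiers and sums over its points become countable
  (\<open>measurable_Bex_points\<close>, \<open>measurable_point_sum\<close>). The foil, its order and its successor relation are
  defined by quantifiers over the points and over the numbers of iterations.

  Uniqueness fails already when all foils have three points, because such a foil can be traversed in
  two cyclic directions. The randomly translated lattice, with each of its points replaced by three
  nearby points in a row, is a stationary process which carries such foils.\<close>

section \<open>Measurable enumeration of a configuration\<close>

lemma space_configs: "space configs = {\<phi>. locally_finite_config \<phi>}"
  unfolding configs_def by (rule space_measure_of) auto

lemma num_points_measurable [measurable]: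
  assumes "B \<in> sets borel"
  shows "(\<lambda>\<phi>. num_points \<phi> B) \<in> borel_measurable configs"
proof (rule measurableI)
  fix A :: "ennreal set" assume A: "A \<in> sets borel"
  have "(\<lambda>\<phi>. num_points \<phi> B) -` A \<inter> space configs =
      {\<phi>. locally_finite_config \<phi> \<and> num_points \<phi> B \<in> A}"
    by (auto simp: space_configs)
  also have "\<dots> \<in> sets configs"
    unfolding configs_def using A assms by (subst sets_measure_of) auto
  finally show "(\<lambda>\<phi>. num_points \<phi> B) -` A \<inter> space configs \<in> sets configs" .
qed simp

lemma measurable_configsI:
  fixes g :: "'w \<Rightarrow> 'a::euclidean_space set"
  assumes "\<And>w. w \<in> space M \<Longrightarrow> locally_finite_config (g w)"
    and "\<And>B. B \<in> sets borel \<Longrightarrow> (\<lambda>w. num_points (g w) B) \<in> borel_measurable M"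
  shows "g \<in> measurable M configs"
  unfolding configs_def
proof (rule measurable_measure_of)
  fix y :: "'a set set" assume "y \<in> {{\<phi>. locally_finite_config \<phi> \<and> num_points \<phi> B \<in> A} | B A.
        B \<in> sets borel \<and> A \<in> sets borel}"
  then obtain B A where y: "y = {\<phi>. locally_finite_config \<phi> \<and> num_points \<phi> B \<in> A}"
    and [measurable]: "B \<in> sets borel" "A \<in> sets borel" by auto
  have "g -` y \<inter> space M = (\<lambda>w. num_points (g w) B) -` A \<inter> space M"
    using assms(1) by (auto simp: y)
  also have "\<dots> \<in> sets M"
    by (rule measurable_sets[OF assms(2)]) measurable
  finally show "g -` y \<inter> space M \<in> sets M" .
qed (use assms in auto)

lemma num_points_eq_1_iff: "num_points \<phi> B = 1 \<longleftrightarrow> (\<exists>x. \<phi> \<inter> B = {x})"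
proof -
  have "num_points \<phi> B = 1 \<longleftrightarrow> finite (\<phi> \<inter> B) \<and> card (\<phi> \<inter> B) = 1"
    unfolding num_points_def by (auto simp: emeasure_count_space)
  also have "\<dots> \<longleftrightarrow> (\<exists>x. \<phi> \<inter> B = {x})"
    by (auto simp: card_1_singleton_iff)
  finally show ?thesis .
qed

text \<open>The members of a base of the topology that contain exactly one point of a configuration name the
  points of this configuration, but each point has many names. Sums over the points need unique
  names, and \<open>first_cell\<close> selects the first one.\<close>

definition cell :: "nat \<Rightarrow> 'a::euclidean_space set" where
  "cell = (SOME B. (\<forall>n. open (B n)) \<and> (\<forall>S. open S \<longrightarrow> (\<exists>k. S = \<Union>{B n |n. n \<in> k})))"

lemma cell_basis: "(\<forall>n. open (cell n :: 'a::euclidean_space set)) \<and>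
    (\<forall>S :: 'a set. open S \<longrightarrow> (\<exists>k. S = \<Union>{cell n |n. n \<in> k}))"
proof -
  have "\<exists>B :: nat \<Rightarrow> 'a set. (\<forall>n. open (B n)) \<and> (\<forall>S. open S \<longrightarrow> (\<exists>k. S = \<Union>{B n |n. n \<in> k}))"
    by (rule univ_second_countable_sequence) blast
  from someI_ex[OF this] show ?thesis unfolding cell_def .
qed

lemma cell_borel [measurable]: "cell k \<in> sets borel"
  by (intro borel_open) (simp add: cell_basis)

lemma ex_isolating_cell:
  assumes "locally_finite_config \<phi>" "x \<in> \<phi>"
  shows "\<exists>k. \<phi> \<inter> cell k = {x}"
proof -
  have fin: "finite (\<phi> \<inter> ball x 1)"
    using assms(1) by (auto simp: locally_finite_config_def)
  let ?S = "ball x 1 - (\<phi> \<inter> ball x 1 - {x})"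
  have "open ?S" using fin by (intro open_Diff finite_imp_closed) auto
  then obtain K where K: "?S = \<Union>{cell n |n. n \<in> K}"
    using cell_basis[THEN conjunct2, THEN spec, THEN mp] by blast
  have "x \<in> ?S" by simp
  then obtain k where "k \<in> K" "x \<in> cell k" unfolding K by auto
  moreover from this have "cell k \<subseteq> ?S" unfolding K by auto
  ultimately have "\<phi> \<inter> cell k = {x}" using assms(2) by auto
  then show ?thesis ..
qed

definition cell_point :: "nat \<Rightarrow> 'a::euclidean_space set \<Rightarrow> 'a" where
  "cell_point k \<phi> = (if num_points \<phi> (cell k) = 1 then THE x. \<phi> \<inter> cell k = {x} else 0)"

lemma cell_point_eq: "\<phi> \<inter> cell k = {x} \<Longrightarrow> cell_point k \<phi> = x"
  unfolding cell_point_def by (auto simp: num_points_eq_1_iff)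

text \<open>A cell that isolates a point turns statements about the position of this point into statements about
  counts: the point lies in \<open>A\<close> iff the intersection of the cell with \<open>A\<close> still contains one point.\<close>

lemma cell_point_measurable [measurable]:
  "(cell_point k :: 'a::euclidean_space set \<Rightarrow> 'a) \<in> borel_measurable configs"
proof -
  have isolated: "{\<phi> \<in> space configs. num_points \<phi> (cell k :: 'a set) = 1} \<in> sets configs"
    by measurable
  have "(\<lambda>\<phi> :: 'a set. THE x. \<phi> \<inter> cell k = {x})
    \<in> borel_measurable (restrict_space configs {\<phi>. num_points \<phi> (cell k) = 1})" (is "?t \<in> borel_measurable ?R")
  proof (rule measurableI)
    fix A :: "'a set" assume [measurable]: "A \<in> sets borel"
    have "num_points \<phi> (cell k \<inter> A) = 1 \<longleftrightarrow> ?t \<phi> \<in> A" if "num_points \<phi> (cell k) = 1" for \<phi>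
    proof -
      from that obtain x where x: "\<phi> \<inter> cell k = {x}" by (auto simp: num_points_eq_1_iff)
      then have "\<phi> \<inter> (cell k \<inter> A) = (if x \<in> A then {x} else {})" by auto
      then have "num_points \<phi> (cell k \<inter> A) = 1 \<longleftrightarrow> x \<in> A"
        unfolding num_points_eq_1_iff by auto
      with x show ?thesis by simp
    qed
    then have "?t -` A \<inter> space ?R = {\<phi> \<in> space ?R. num_points \<phi> (cell k \<inter> A) = 1}"
      by (auto simp: space_restrict_space)
    also have "\<dots> \<in> sets ?R"
      by (measurable, rule measurable_restrict_space1) measurable
    finally show "?t -` A \<inter> space ?R \<in> sets ?R" .
  qed simp
  moreover have "(\<lambda>\<phi> :: 'a set. 0 :: 'a) \<in> borel_measurable (restrict_space configs {\<phi>. num_points \<phi> (cell k) \<noteq> 1})"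
    by simp
  ultimately have "(\<lambda>\<phi> :: 'a set. if num_points \<phi> (cell k) = 1 then THE x. \<phi> \<inter> cell k = {x} else 0)
      \<in> borel_measurable configs"
    unfolding measurable_If_restrict_space_iff[OF isolated] by (rule conjI)
  then show ?thesis unfolding cell_point_def[abs_def] .
qed

definition first_cell :: "nat \<Rightarrow> 'a::euclidean_space set \<Rightarrow> bool" where
  "first_cell k \<phi> \<longleftrightarrow> num_points \<phi> (cell k) = 1 \<and>
     (\<forall>j<k. \<not> (num_points \<phi> (cell j) = 1 \<and> cell_point j \<phi> = cell_point k \<phi>))"

lemma first_cell_measurable [measurable]: "Measurable.pred configs (first_cell k)"
  unfolding first_cell_def[abs_def] by measurable

lemma bij_betw_cell_point:
  assumes "locally_finite_config \<phi>"
  shows "bij_betw (\<lambda>k. cell_point k \<phi>) {k. first_cell k \<phi>} \<phi>"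
proof (rule bij_betwI')
  fix j k assume jk: "j \<in> {k. first_cell k \<phi>}" "k \<in> {k. first_cell k \<phi>}"
  show "(cell_point j \<phi> = cell_point k \<phi>) = (j = k)"
    using jk unfolding first_cell_def mem_Collect_eq by (metis linorder_neqE_nat)
next
  fix k assume "k \<in> {k. first_cell k \<phi>}"
  then obtain x where x: "\<phi> \<inter> cell k = {x}" by (auto simp: first_cell_def num_points_eq_1_iff)
  with cell_point_eq[OF x] show "cell_point k \<phi> \<in> \<phi>" by auto
next
  fix x assume "x \<in> \<phi>"
  define k where "k = (LEAST k. \<phi> \<inter> cell k = {x})"
  have k: "\<phi> \<inter> cell k = {x}"
    unfolding k_def by (rule LeastI_ex) (rule ex_isolating_cell[OF assms \<open>x \<in> \<phi>\<close>])
  have "first_cell k \<phi>"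
    unfolding first_cell_def
  proof (intro conjI allI impI)
    show "num_points \<phi> (cell k) = 1" using k by (auto simp: num_points_eq_1_iff)
    fix j assume "j < k"
    then have "\<phi> \<inter> cell j \<noteq> {x}" unfolding k_def by (rule not_less_Least)
    then show "\<not> (num_points \<phi> (cell j) = 1 \<and> cell_point j \<phi> = cell_point k \<phi>)"
      unfolding num_points_eq_1_iff cell_point_eq[OF k] by (metis cell_point_eq)
  qed
  with cell_point_eq[OF k] show "\<exists>k\<in>{k. first_cell k \<phi>}. x = cell_point k \<phi>" by auto
qed

text \<open>A quantifier over the points of a configuration is a quantifier over the countably many cells.\<close>

lemma measurable_Bex_points:
  assumes [measurable]: "g \<in> measurable M configs"
    and [measurable]: "Measurable.pred (M \<Otimes>\<^sub>M borel) (\<lambda>p. P (fst p) (snd p))"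
  shows "Measurable.pred M (\<lambda>w. \<exists>x\<in>g w. P w x)"
proof -
  have "(\<exists>x\<in>g w. P w x) \<longleftrightarrow> (\<exists>k. first_cell k (g w) \<and> P w (cell_point k (g w)))"
    if "w \<in> space M" for w
  proof -
    have "g w \<in> space configs" using that assms(1) by (rule measurable_space[rotated])
    then have "bij_betw (\<lambda>k. cell_point k (g w)) {k. first_cell k (g w)} (g w)"
      by (intro bij_betw_cell_point) (simp add: space_configs)
    then have "(\<lambda>k. cell_point k (g w)) ` {k. first_cell k (g w)} = g w"
      by (simp add: bij_betw_def)
    then have "(\<exists>x\<in>g w. P w x) \<longleftrightarrow> (\<exists>x\<in>(\<lambda>k. cell_point k (g w)) ` {k. first_cell k (g w)}. P w x)"
      by (simp only:)
    also have "\<dots> \<longleftrightarrow> (\<exists>k. first_cell k (g w) \<and> P w (cell_point k (g w)))"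
      by auto
    finally show ?thesis .
  qed
  moreover have "Measurable.pred M (\<lambda>w. \<exists>k. first_cell k (g w) \<and> P w (cell_point k (g w)))"
  proof -
    have [measurable]: "Measurable.pred M (\<lambda>w. P w (cell_point k (g w)))" for k
    proof -
      have "(\<lambda>w. (w, cell_point k (g w))) \<in> measurable M (M \<Otimes>\<^sub>M borel)" by measurable
      from measurable_compose[OF this assms(2)] show ?thesis by simp
    qed
    show ?thesis by measurable
  qed
  ultimately show ?thesis by (subst measurable_cong) auto
qed

lemma measurable_point_sum:
  assumes [measurable]: "g \<in> measurable M configs"
    and u: "(\<lambda>p. u (fst p) (snd p)) \<in> borel_measurable (M \<Otimes>\<^sub>M borel)"
  shows "(\<lambda>w. \<integral>\<^sup>+x. u w x \<partial>count_space (g w)) \<in> borel_measurable M"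
proof -
  have [measurable]: "(\<lambda>w. u w (cell_point k (g w))) \<in> borel_measurable M" for k
  proof -
    have "(\<lambda>w. (w, cell_point k (g w))) \<in> measurable M (M \<Otimes>\<^sub>M borel)" by measurable
    from measurable_compose[OF this u] show ?thesis by simp
  qed
  have "(\<integral>\<^sup>+x. u w x \<partial>count_space (g w)) =
      (\<Sum>k. u w (cell_point k (g w)) * indicator {w. first_cell k (g w)} w)"
    if "w \<in> space M" for w
  proof -
    have "g w \<in> space configs" using that assms(1) by (rule measurable_space[rotated])
    then have "bij_betw (\<lambda>k. cell_point k (g w)) {k. first_cell k (g w)} (g w)"
      by (intro bij_betw_cell_point) (simp add: space_configs)
    from nn_integral_bij_count_space[OF this, of "u w"]
    have "(\<integral>\<^sup>+x. u w x \<partial>count_space (g w)) =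
        (\<integral>\<^sup>+k. u w (cell_point k (g w)) \<partial>count_space {k. first_cell k (g w)})" by simp
    also have "\<dots> = (\<integral>\<^sup>+k. u w (cell_point k (g w)) * indicator {k. first_cell k (g w)} k
        \<partial>count_space UNIV)"
      by (simp add: nn_integral_count_space_indicator)
    also have "\<dots> = (\<Sum>k. u w (cell_point k (g w)) * indicator {k. first_cell k (g w)} k)"
      by (rule nn_integral_count_space_nat)
    finally show ?thesis by (simp add: indicator_def)
  qed
  moreover have "(\<lambda>w. \<Sum>k. u w (cell_point k (g w)) * indicator {w. first_cell k (g w)} w)
      \<in> borel_measurable M"
    by measurable
  ultimately show ?thesis by (subst measurable_cong) auto
qed

lemma num_points_eq_nn_integral:
  "num_points \<phi> B = (\<integral>\<^sup>+x. indicator B x \<partial>count_space \<phi>)"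
proof -
  have "num_points \<phi> B = (\<integral>\<^sup>+x. indicator (\<phi> \<inter> B) x \<partial>count_space UNIV)"
    unfolding num_points_def by simp
  also have "\<dots> = (\<integral>\<^sup>+x. indicator B x * indicator \<phi> x \<partial>count_space UNIV)"
    by (intro nn_integral_cong) (auto simp: indicator_def)
  also have "\<dots> = (\<integral>\<^sup>+x. indicator B x \<partial>count_space \<phi>)"
    by (simp add: nn_integral_count_space_indicator)
  finally show ?thesis .
qed

lemma measurable_mem_points [measurable (raw)]:
  assumes [measurable]: "g \<in> measurable M configs" "t \<in> borel_measurable M"
  shows "Measurable.pred M (\<lambda>w. t w \<in> g w)"
proof -
  have "Measurable.pred M (\<lambda>w. \<exists>x\<in>g w. x = t w)"
    by (rule measurable_Bex_points) measurable
  then show ?thesis by (simp cong: bex_cong)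
qed

lemma bij_betw_translate: "bij_betw (\<lambda>x. x - t) \<phi> (translate t \<phi>)"
  unfolding translate_def by (rule inj_on_imp_bij_betw) (simp add: inj_on_def)

lemma locally_finite_translate:
  assumes "locally_finite_config \<phi>"
  shows "locally_finite_config (translate t \<phi>)"
  unfolding locally_finite_config_def
proof (intro allI impI)
  fix B :: "'a set" assume "bounded B"
  then have "bounded ((\<lambda>x. t + x) ` B)" by (rule bounded_translation)
  then have "finite (\<phi> \<inter> (\<lambda>x. t + x) ` B)"
    using assms unfolding locally_finite_config_def by blast
  then have "finite ((\<lambda>x. x - t) ` (\<phi> \<inter> (\<lambda>x. t + x) ` B))" by blast
  moreover have "translate t \<phi> \<inter> B \<subseteq> (\<lambda>x. x - t) ` (\<phi> \<inter> (\<lambda>x. t + x) ` B)"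
    by (force simp: translate_def)
  ultimately show "finite (translate t \<phi> \<inter> B)" by (rule finite_subset[rotated])
qed

text \<open>Joint measurability in the configuration and the translation vector. It holds because each count of
  the translated configuration is a sum over the points of the original one.\<close>

lemma measurable_translate [measurable (raw)]:
  fixes g :: "'w \<Rightarrow> 'a::euclidean_space set"
  assumes [measurable]: "g \<in> measurable M configs" "t \<in> borel_measurable M"
  shows "(\<lambda>w. translate (t w) (g w)) \<in> measurable M configs"
proof (rule measurable_configsI)
  fix w assume "w \<in> space M"
  with measurable_space[OF assms(1) this] show "locally_finite_config (translate (t w) (g w))"
    by (auto simp: space_configs intro: locally_finite_translate)
next
  fix B :: "'a set" assume [measurable]: "B \<in> sets borel"
  have "(\<lambda>w. \<integral>\<^sup>+x. indicator B (x - t w) \<partial>count_space (g w)) \<in> borel_measurable M"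
    by (rule measurable_point_sum) measurable
  also have "(\<lambda>w. \<integral>\<^sup>+x. indicator B (x - t w) \<partial>count_space (g w)) =
      (\<lambda>w. num_points (translate (t w) (g w)) B)"
    unfolding num_points_eq_nn_integral
    by (intro ext nn_integral_bij_count_space bij_betw_translate)
  finally show "(\<lambda>w. num_points (translate (t w) (g w)) B) \<in> borel_measurable M" .
qed

text \<open>Points selected by a definable property are measurable: the selected point lies in \<open>A\<close> iff some
  point of the configuration has the property and lies in \<open>A\<close>.\<close>

lemma measurable_The_point:
  fixes P :: "'w \<Rightarrow> 'a::euclidean_space \<Rightarrow> bool"
  assumes g [measurable]: "g \<in> measurable M configs" and d [measurable]: "d \<in> borel_measurable M"
    and [measurable]: "Measurable.pred (M \<Otimes>\<^sub>M borel) (\<lambda>p. P (fst p) (snd p))"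
  shows "(\<lambda>w. if \<exists>!y. y \<in> g w \<and> P w y then THE y. y \<in> g w \<and> P w y else d w) \<in> borel_measurable M"
    (is "?h \<in> _")
proof (rule measurableI)
  fix A :: "'a set" assume [measurable]: "A \<in> sets borel"
  have *: "(\<exists>!y. y \<in> g w \<and> P w y) \<longleftrightarrow>
      (\<exists>x\<in>g w. P w x) \<and> \<not> (\<exists>x\<in>g w. P w x \<and> (\<exists>y\<in>g w. P w y \<and> x \<noteq> y))" for w
    by blast
  have [measurable]: "Measurable.pred ((M \<Otimes>\<^sub>M borel) \<Otimes>\<^sub>M borel)
      (\<lambda>p :: ('w \<times> 'a) \<times> 'a. P (fst (fst p)) (snd p))"
  proof -
    have "(\<lambda>p :: ('w \<times> 'a) \<times> 'a. (fst (fst p), snd p)) \<in> measurable ((M \<Otimes>\<^sub>M borel) \<Otimes>\<^sub>M borel) (M \<Otimes>\<^sub>M borel)"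
      by measurable
    from measurable_compose[OF this assms(3)] show ?thesis by simp
  qed
  have [measurable]: "Measurable.pred (M \<Otimes>\<^sub>M borel) (\<lambda>p. \<exists>y\<in>g (fst p). P (fst p) y \<and> snd p \<noteq> y)"
    by (rule measurable_Bex_points) measurable
  have uniq [measurable]: "Measurable.pred M (\<lambda>w. \<exists>!y. y \<in> g w \<and> P w y)"
    unfolding * by (intro pred_intros_logic measurable_Bex_points) measurable
  have [measurable]: "Measurable.pred M (\<lambda>w. \<exists>y\<in>g w. P w y \<and> y \<in> A)"
    by (intro measurable_Bex_points) measurable
  have iff: "?h w \<in> A \<longleftrightarrow> (if \<exists>!y. y \<in> g w \<and> P w y then \<exists>y\<in>g w. P w y \<and> y \<in> A else d w \<in> A)" for w
  proof (cases "\<exists>!y. y \<in> g w \<and> P w y")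
    case True
    then obtain y where "y \<in> g w \<and> P w y" "\<And>z. z \<in> g w \<and> P w z \<Longrightarrow> z = y" by blast
    note y = this
    have "(THE y. y \<in> g w \<and> P w y) = y" using y by (rule the_equality)
    moreover have "(\<exists>z\<in>g w. P w z \<and> z \<in> A) \<longleftrightarrow> y \<in> A" using y by blast
    ultimately show ?thesis using True by (simp only: if_True simp_thms)
  qed (simp only: if_False)
  have "?h -` A \<inter> space M = {w \<in> space M. ?h w \<in> A}" by blast
  also have "\<dots> =
      {w\<in>space M. if \<exists>!y. y \<in> g w \<and> P w y then \<exists>y\<in>g w. P w y \<and> y \<in> A else d w \<in> A}"
    by (simp only: iff)
  also have "\<dots> \<in> sets M" by measurable
  finally show "?h -` A \<inter> space M \<in> sets M" .
qed simp

section \<open>Cyclic successors in orders of finite or integer type\<close>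

text \<open>A total order with finite intervals is isomorphic to a set of integers, and \<open>no_max\<close> and \<open>no_min\<close>
  leave only the finite sets and the set of all integers.\<close>

locale finite_or_integer_order =
  fixes A :: "'b set" and lt :: "'b \<Rightarrow> 'b \<Rightarrow> bool"
  assumes irrefl: "x \<in> A \<Longrightarrow> \<not> lt x x"
    and trans: "x \<in> A \<Longrightarrow> y \<in> A \<Longrightarrow> z \<in> A \<Longrightarrow> lt x y \<Longrightarrow> lt y z \<Longrightarrow> lt x z"
    and total: "x \<in> A \<Longrightarrow> y \<in> A \<Longrightarrow> x \<noteq> y \<Longrightarrow> lt x y \<or> lt y x"
    and finite_interval: "x \<in> A \<Longrightarrow> y \<in> A \<Longrightarrow> finite {z \<in> A. lt x z \<and> lt z y}"
    and no_max: "infinite A \<Longrightarrow> x \<in> A \<Longrightarrow> \<exists>y\<in>A. lt x y"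
    and no_min: "infinite A \<Longrightarrow> x \<in> A \<Longrightarrow> \<exists>y\<in>A. lt y x"

text \<open>Reversing the order turns this relation into its converse. The existence and uniqueness of a
  predecessor are therefore those of a successor in the reversed order.\<close>

definition cyclic_succ :: "'b set \<Rightarrow> ('b \<Rightarrow> 'b \<Rightarrow> bool) \<Rightarrow> 'b \<Rightarrow> 'b \<Rightarrow> bool" where
  "cyclic_succ A lt x y \<longleftrightarrow>
     lt x y \<and> \<not> (\<exists>z\<in>A. lt x z \<and> lt z y) \<or> \<not> (\<exists>z\<in>A. lt x z) \<and> \<not> (\<exists>z\<in>A. lt z y)"

lemma cyclic_succ_dual: "cyclic_succ A (\<lambda>x y. lt y x) y x = cyclic_succ A lt x y"
  unfolding cyclic_succ_def by blast

context finite_or_integer_order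
begin

lemma dual: "finite_or_integer_order A (\<lambda>x y. lt y x)"
proof
  fix x y assume "x \<in> A" "y \<in> A"
  then show "finite {z \<in> A. lt z x \<and> lt y z}"
    using finite_interval[of y x] by (simp add: conj_commute)
qed (use irrefl trans total no_max no_min in blast)+

lemma ex_least:
  assumes "S \<subseteq> A" "finite S" "S \<noteq> {}"
  obtains m where "m \<in> S" "\<And>x. x \<in> S \<Longrightarrow> x \<noteq> m \<Longrightarrow> lt m x"
proof -
  have "asymp_on S lt"
    by (rule asymp_onI) (use assms(1) irrefl trans in blast)
  moreover have "transp_on S lt"
    by (rule transp_onI) (use assms(1) trans in blast)
  ultimately obtain m where m: "m \<in> S" "\<forall>x\<in>S. x \<noteq> m \<longrightarrow> \<not> lt x m"
    using Finite_Set.bex_min_element[OF assms(2) _ _ assms(3), of lt] by blast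
  show thesis
  proof
    show "m \<in> S" by fact
    show "lt m x" if "x \<in> S" "x \<noteq> m" for x
      using m that assms(1) total by blast
  qed
qed

lemma ex_cover:
  assumes "x \<in> A" "y \<in> A" "lt x y"
  shows "\<exists>s\<in>A. lt x s \<and> \<not> (\<exists>z\<in>A. lt x z \<and> lt z s)"
proof -
  let ?S = "insert y {z \<in> A. lt x z \<and> lt z y}"
  have S: "?S \<subseteq> A" "finite ?S" "?S \<noteq> {}" using assms finite_interval by auto
  obtain m where m: "m \<in> ?S" "\<And>z. z \<in> ?S \<Longrightarrow> z \<noteq> m \<Longrightarrow> lt m z"
    by (rule ex_least[OF S]) (rule that)
  have mA: "m \<in> A" "lt x m" using m(1) assms by auto
  moreover have False if z: "z \<in> A" "lt x z" "lt z m" for z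
  proof -
    have "z \<in> ?S" using z m(1) assms trans by blast
    moreover have "z \<noteq> m" using z irrefl by blast
    ultimately have "lt m z" using m(2) by blast
    then show False using z mA irrefl trans by blast
  qed
  ultimately show ?thesis by blast
qed

text \<open>A point below another one has a least point above it, by finiteness of intervals. A greatest point
  exists only if the set is finite, and then there is a least point to return to.\<close>

lemma ex1_cyclic_succ:
  assumes "x \<in> A"
  shows "\<exists>!y. y \<in> A \<and> cyclic_succ A lt x y"
proof (cases "\<exists>y\<in>A. lt x y")
  case True
  then obtain s where s: "s \<in> A" "lt x s" "\<not> (\<exists>z\<in>A. lt x z \<and> lt z s)"
    using ex_cover assms by blast
  show ?thesis
  proof (rule ex1I)
    show "s \<in> A \<and> cyclic_succ A lt x s" using s unfolding cyclic_succ_def by blast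
    fix y assume "y \<in> A \<and> cyclic_succ A lt x y"
    then have y: "y \<in> A" "lt x y" "\<not> (\<exists>z\<in>A. lt x z \<and> lt z y)"
      using True unfolding cyclic_succ_def by blast+
    then show "y = s" using s total[of y s] by blast
  qed
next
  case False
  then have fin: "finite A" using no_max assms by blast
  then obtain m where m: "m \<in> A" "\<And>x. x \<in> A \<Longrightarrow> x \<noteq> m \<Longrightarrow> lt m x"
    using ex_least[of A] assms by blast
  show ?thesis
  proof (rule ex1I)
    show "m \<in> A \<and> cyclic_succ A lt x m"
      using m False irrefl trans unfolding cyclic_succ_def by blast
    fix y assume "y \<in> A \<and> cyclic_succ A lt x y"
    then show "y = m" using m False unfolding cyclic_succ_def by blast
  qed
qed

lemma ex1_cyclic_pred:
  assumes "y \<in> A"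
  shows "\<exists>!x. x \<in> A \<and> cyclic_succ A lt x y"
  using finite_or_integer_order.ex1_cyclic_succ[OF dual assms] unfolding cyclic_succ_dual[of A lt] .

text \<open>Each step strictly shrinks the finite interval between the current point and \<open>y\<close>.\<close>

lemma cyclic_succ_reaches:
  assumes H: "\<And>x. x \<in> A \<Longrightarrow> H x \<in> A \<and> cyclic_succ A lt x (H x)"
    and "x \<in> A" "y \<in> A" "lt x y"
  shows "\<exists>i. (H ^^ i) x = y"
  using assms(2-4)
proof (induction "card {z \<in> A. lt x z \<and> lt z y}" arbitrary: x rule: less_induct)
  case less
  have cover: "lt x (H x)" "\<not> (\<exists>z\<in>A. lt x z \<and> lt z (H x))"
    using H[of x] less.prems unfolding cyclic_succ_def by blast+
  have HA: "H x \<in> A" using H less.prems by blast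
  show ?case
  proof (cases "H x = y")
    case True
    then have "(H ^^ 1) x = y" by simp
    then show ?thesis ..
  next
    case False
    then have lt: "lt (H x) y" using total[of "H x" y] cover HA less.prems by blast
    have "{z \<in> A. lt (H x) z \<and> lt z y} \<subset> {z \<in> A. lt x z \<and> lt z y}"
    proof (rule psubsetI)
      show "{z \<in> A. lt (H x) z \<and> lt z y} \<subseteq> {z \<in> A. lt x z \<and> lt z y}"
        using trans cover HA less.prems by blast
      have "H x \<in> {z \<in> A. lt x z \<and> lt z y}" using lt cover HA by blast
      moreover have "H x \<notin> {z \<in> A. lt (H x) z \<and> lt z y}" using irrefl HA by blast
      ultimately show "{z \<in> A. lt (H x) z \<and> lt z y} \<noteq> {z \<in> A. lt x z \<and> lt z y}" by blast
    qed
    then have "card {z \<in> A. lt (H x) z \<and> lt z y} < card {z \<in> A. lt x z \<and> lt z y}"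
      by (rule psubset_card_mono[rotated]) (use finite_interval less.prems in blast)
    from less.hyps[OF this HA _ lt] obtain i where "(H ^^ i) (H x) = y"
      using less.prems by blast
    then have "(H ^^ Suc i) x = y" by (simp add: funpow_swap1)
    then show ?thesis ..
  qed
qed

end

section \<open>The order of a foil\<close>

definition basis_list :: "'a::euclidean_space list" where
  "basis_list = (SOME bs. set bs = Basis)"

lemma set_basis_list: "set basis_list = Basis"
  unfolding basis_list_def using finite_list[OF finite_Basis] by (rule someI_ex)

definition lex_less :: "'a::euclidean_space \<Rightarrow> 'a \<Rightarrow> bool" where
  "lex_less x y \<longleftrightarrow> (\<exists>i<length (basis_list :: 'a list).
     (\<forall>j<i. x \<bullet> basis_list ! j = y \<bullet> basis_list ! j) \<and> x \<bullet> basis_list ! i < y \<bullet> basis_list ! i)"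

lemma lex_less_irrefl: "\<not> lex_less x x"
  unfolding lex_less_def by simp

lemma lex_less_trans:
  assumes "lex_less x y" "lex_less y z"
  shows "lex_less x z"
proof -
  obtain i where i: "i < length (basis_list :: 'a list)"
      "\<And>j. j < i \<Longrightarrow> x \<bullet> basis_list ! j = y \<bullet> basis_list ! j" "x \<bullet> basis_list ! i < y \<bullet> basis_list ! i"
    using assms(1) unfolding lex_less_def by blast
  obtain k where k: "k < length (basis_list :: 'a list)"
      "\<And>j. j < k \<Longrightarrow> y \<bullet> basis_list ! j = z \<bullet> basis_list ! j" "y \<bullet> basis_list ! k < z \<bullet> basis_list ! k"
    using assms(2) unfolding lex_less_def by blast
  have "(\<forall>j<min i k. x \<bullet> basis_list ! j = z \<bullet> basis_list ! j)" using i(2) k(2) by simp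
  moreover have "x \<bullet> basis_list ! min i k < z \<bullet> basis_list ! min i k"
    using i(2)[of k] i(3) k(2)[of i] k(3) by (cases i k rule: linorder_cases) auto
  ultimately show ?thesis
    unfolding lex_less_def using i(1) k(1) by (intro exI[of _ "min i k"]) auto
qed

lemma lex_less_total:
  assumes "x \<noteq> y"
  shows "lex_less x y \<or> lex_less y x"
proof -
  obtain b where "b \<in> Basis" "x \<bullet> b \<noteq> y \<bullet> b" using assms euclidean_eqI by blast
  then obtain i0 where "i0 < length (basis_list :: 'a list)" "x \<bullet> basis_list ! i0 \<noteq> y \<bullet> basis_list ! i0"
    unfolding set_basis_list[symmetric] in_set_conv_nth by blast
  then have ex: "\<exists>i. i < length (basis_list :: 'a list) \<and> x \<bullet> basis_list ! i \<noteq> y \<bullet> basis_list ! i" by blast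
  define i where "i = (LEAST i. i < length (basis_list :: 'a list) \<and> x \<bullet> basis_list ! i \<noteq> y \<bullet> basis_list ! i)"
  have i: "i < length (basis_list :: 'a list)" "x \<bullet> basis_list ! i \<noteq> y \<bullet> basis_list ! i"
    using LeastI_ex[OF ex] unfolding i_def by blast+
  have "x \<bullet> basis_list ! j = y \<bullet> basis_list ! j" if "j < i" for j
    using not_less_Least[OF that[unfolded i_def]] that i(1) by auto
  then have "\<forall>j<i. x \<bullet> basis_list ! j = y \<bullet> basis_list ! j" "\<forall>j<i. y \<bullet> basis_list ! j = x \<bullet> basis_list ! j"
    by simp_all
  moreover have "x \<bullet> basis_list ! i < y \<bullet> basis_list ! i \<or> y \<bullet> basis_list ! i < x \<bullet> basis_list ! i"
    using i(2) by (rule linorder_neqE) auto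
  ultimately show ?thesis unfolding lex_less_def using i(1) by blast
qed

lemma lex_less_diff: "lex_less (x - t) (y - t) = lex_less x y"
  unfolding lex_less_def by (simp add: inner_diff_left)

text \<open>There is at most one such \<open>n\<close>: once two orbits have met they stay together.\<close>

definition foil_less :: "('a::euclidean_space set \<Rightarrow> 'a) \<Rightarrow> 'a set \<Rightarrow> 'a \<Rightarrow> 'a \<Rightarrow> bool" where
  "foil_less f \<phi> x y \<longleftrightarrow> (\<exists>n. lex_less ((point_shift f \<phi> ^^ n) x) ((point_shift f \<phi> ^^ n) y) \<and>
     (point_shift f \<phi> ^^ Suc n) x = (point_shift f \<phi> ^^ Suc n) y)"

lemma funpow_eq_mono:
  fixes F :: "'b \<Rightarrow> 'b"
  assumes "(F ^^ n) x = (F ^^ n) y" "n \<le> m"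
  shows "(F ^^ m) x = (F ^^ m) y"
proof -
  obtain k where "m = k + n" using assms(2) by (metis le_iff_add add.commute)
  then show ?thesis using assms(1) by (simp add: funpow_add)
qed

lemma foil_less_irrefl: "\<not> foil_less f \<phi> x x"
  unfolding foil_less_def by (simp add: lex_less_irrefl)

text \<open>If the orbits of \<open>x\<close> and \<open>y\<close> are last distinct at level \<open>n\<close>, and those of \<open>y\<close> and \<open>z\<close> at level \<open>m\<close>,
  then those of \<open>x\<close> and \<open>z\<close> are last distinct at level \<open>max n m\<close>. Unless \<open>n = m\<close>, two of the three
  orbits have already met there, so the comparison reduces to one of the given ones.\<close>

lemma foil_less_trans:
  assumes "foil_less f \<phi> x y" "foil_less f \<phi> y z"
  shows "foil_less f \<phi> x z"
proof -
  let ?F = "point_shift f \<phi>"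
  obtain n where n: "lex_less ((?F ^^ n) x) ((?F ^^ n) y)" "(?F ^^ Suc n) x = (?F ^^ Suc n) y"
    using assms(1) unfolding foil_less_def by blast
  obtain m where m: "lex_less ((?F ^^ m) y) ((?F ^^ m) z)" "(?F ^^ Suc m) y = (?F ^^ Suc m) z"
    using assms(2) unfolding foil_less_def by blast
  have "(?F ^^ Suc (max n m)) x = (?F ^^ Suc (max n m)) z"
    using funpow_eq_mono[OF n(2), of "Suc (max n m)"] funpow_eq_mono[OF m(2), of "Suc (max n m)"]
    by simp
  moreover have "lex_less ((?F ^^ max n m) x) ((?F ^^ max n m) z)"
  proof (cases n m rule: linorder_cases)
    case less
    then show ?thesis using m(1) funpow_eq_mono[OF n(2), of m] by (simp add: max_def)
  next
    case equal
    then show ?thesis using m(1) n(1) lex_less_trans by auto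
  next
    case greater
    then show ?thesis using n(1) funpow_eq_mono[OF m(2), of n] by (simp add: max_def)
  qed
  ultimately show ?thesis unfolding foil_less_def by blast
qed

lemma foil_refl: "x \<in> \<phi> \<Longrightarrow> x \<in> foil f \<phi> x"
  by (auto simp: foil_def)

lemma foil_sym: "y \<in> foil f \<phi> x \<Longrightarrow> x \<in> \<phi> \<Longrightarrow> x \<in> foil f \<phi> y"
  unfolding foil_def by (auto intro: sym)

lemma foil_trans:
  assumes "y \<in> foil f \<phi> x" "z \<in> foil f \<phi> y"
  shows "z \<in> foil f \<phi> x"
proof -
  let ?F = "point_shift f \<phi>"
  obtain n m where "(?F ^^ n) x = (?F ^^ n) y" "(?F ^^ m) y = (?F ^^ m) z"
    using assms unfolding foil_def by blast
  then have "(?F ^^ max n m) x = (?F ^^ max n m) z"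
    using funpow_eq_mono[of n ?F x y "max n m"] funpow_eq_mono[of m ?F y z "max n m"] by simp
  then show ?thesis using assms(2) unfolding foil_def by blast
qed

lemma foil_eq:
  assumes "y \<in> foil f \<phi> x" "x \<in> \<phi>"
  shows "foil f \<phi> y = foil f \<phi> x"
  using assms foil_trans foil_sym by blast

lemma foil_subset: "foil f \<phi> x \<subseteq> \<phi>"
  by (auto simp: foil_def)

lemma foil_less_total:
  assumes "y \<in> foil f \<phi> x" "x \<noteq> y"
  shows "foil_less f \<phi> x y \<or> foil_less f \<phi> y x"
proof -
  let ?F = "point_shift f \<phi>"
  have ex: "\<exists>n. (?F ^^ n) x = (?F ^^ n) y" using assms unfolding foil_def by blast
  define n where "n = (LEAST n. (?F ^^ n) x = (?F ^^ n) y)"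
  have n: "(?F ^^ n) x = (?F ^^ n) y" unfolding n_def by (rule LeastI_ex[OF ex])
  with assms(2) obtain m where m: "n = Suc m" by (cases n) auto
  then have "(?F ^^ m) x \<noteq> (?F ^^ m) y"
    using not_less_Least[of m "\<lambda>n. (?F ^^ n) x = (?F ^^ n) y"] unfolding n_def[symmetric] by blast
  from lex_less_total[OF this] show ?thesis
    unfolding foil_less_def using n[unfolded m] n[unfolded m, symmetric] by blast
qed

text \<open>The orbits of \<open>F x\<close> and \<open>F y\<close> are those of \<open>x\<close> and \<open>y\<close> without their first points, so they are compared
  at the same two points, one level lower.\<close>

lemma foil_less_shift:
  assumes "foil_less f \<phi> x y"
  shows "point_shift f \<phi> x = point_shift f \<phi> y \<or> foil_less f \<phi> (point_shift f \<phi> x) (point_shift f \<phi> y)"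
proof -
  let ?F = "point_shift f \<phi>"
  obtain n where n: "lex_less ((?F ^^ n) x) ((?F ^^ n) y)" "(?F ^^ Suc n) x = (?F ^^ Suc n) y"
    using assms unfolding foil_less_def by blast
  show ?thesis
  proof (cases n)
    case 0
    then show ?thesis using n(2) by simp
  next
    case (Suc m)
    then have "lex_less ((?F ^^ m) (?F x)) ((?F ^^ m) (?F y))" "(?F ^^ Suc m) (?F x) = (?F ^^ Suc m) (?F y)"
      using n by (simp_all add: funpow_swap1)
    then show ?thesis unfolding foil_less_def by blast
  qed
qed

text \<open>The points whose \<open>N\<close>-th iterate is a given point form an interval of the foil. This is what makes
  order intervals finite when the fibres of the iterates are.\<close>

lemma foil_less_between:
  assumes "(point_shift f \<phi> ^^ N) x = (point_shift f \<phi> ^^ N) y"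
    and "foil_less f \<phi> x z" "foil_less f \<phi> z y"
  shows "(point_shift f \<phi> ^^ N) z = (point_shift f \<phi> ^^ N) x"
proof (rule ccontr)
  let ?F = "point_shift f \<phi>"
  assume neq: "\<not> ?thesis"
  obtain n where n: "lex_less ((?F ^^ n) x) ((?F ^^ n) z)" "(?F ^^ Suc n) x = (?F ^^ Suc n) z"
    using assms(2) unfolding foil_less_def by blast
  obtain m where m: "lex_less ((?F ^^ m) z) ((?F ^^ m) y)" "(?F ^^ Suc m) z = (?F ^^ Suc m) y"
    using assms(3) unfolding foil_less_def by blast
  have "N \<le> n"
    using funpow_eq_mono[OF n(2), of N] neq by (metis not_less_eq_eq)
  then have xy: "(?F ^^ k) x = (?F ^^ k) y" if "n \<le> k" for k
    using funpow_eq_mono[OF assms(1), of k] that by simp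
  show False
  proof (cases n m rule: linorder_cases)
    case less
    then show ?thesis using funpow_eq_mono[OF n(2), of m] xy[of m] m(1) lex_less_irrefl by auto
  next
    case equal
    then show ?thesis using n(1) m(1) xy[of n] lex_less_trans lex_less_irrefl by fastforce
  next
    case greater
    then show ?thesis using funpow_eq_mono[OF m(2), of n] xy[of n] n(1) lex_less_irrefl by auto
  qed
qed

text \<open>The almost sure properties that the deterministic construction of the successor relies on.\<close>

definition regular_foils :: "('a::euclidean_space set \<Rightarrow> 'a) \<Rightarrow> 'a set \<Rightarrow> bool" where
  "regular_foils f \<phi> \<longleftrightarrow>
     (\<forall>n. \<forall>y\<in>\<phi>. finite {x \<in> \<phi>. (point_shift f \<phi> ^^ n) x = y}) \<and>
     (\<forall>x\<in>\<phi>. infinite (foil f \<phi> x) \<longrightarrow>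
        (\<exists>y\<in>foil f \<phi> x. foil_less f \<phi> x y) \<and> (\<exists>y\<in>foil f \<phi> x. foil_less f \<phi> y x))"

lemma funpow_mem: "(\<And>x. x \<in> A \<Longrightarrow> F x \<in> A) \<Longrightarrow> x \<in> A \<Longrightarrow> (F ^^ n) x \<in> A"
  by (induction n) auto

lemma finite_or_integer_order_foil:
  assumes F: "\<And>x. x \<in> \<phi> \<Longrightarrow> point_shift f \<phi> x \<in> \<phi>"
    and reg: "regular_foils f \<phi>" and x: "x \<in> \<phi>"
  shows "finite_or_integer_order (foil f \<phi> x) (foil_less f \<phi>)"
proof
  fix y z assume y: "y \<in> foil f \<phi> x" and z: "z \<in> foil f \<phi> x"
  have z_y: "z \<in> foil f \<phi> y" using foil_trans[OF foil_sym[OF y x] z] .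
  then obtain N where N: "(point_shift f \<phi> ^^ N) y = (point_shift f \<phi> ^^ N) z"
    unfolding foil_def by blast
  have "(point_shift f \<phi> ^^ N) y \<in> \<phi>"
    by (rule funpow_mem[OF F]) (use y foil_subset in blast)+
  then have "finite {w \<in> \<phi>. (point_shift f \<phi> ^^ N) w = (point_shift f \<phi> ^^ N) y}"
    using reg unfolding regular_foils_def by blast
  then show "finite {w \<in> foil f \<phi> x. foil_less f \<phi> y w \<and> foil_less f \<phi> w z}"
    by (rule finite_subset[rotated]) (use foil_less_between[OF N] foil_subset in blast)
  show "foil_less f \<phi> y z \<or> foil_less f \<phi> z y" if "y \<noteq> z"
    using foil_less_total[OF z_y that] .
next
  fix y assume inf: "infinite (foil f \<phi> x)" and y: "y \<in> foil f \<phi> x"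
  have "y \<in> \<phi>" using y foil_subset by blast
  then show "\<exists>z\<in>foil f \<phi> x. foil_less f \<phi> y z" "\<exists>z\<in>foil f \<phi> x. foil_less f \<phi> z y"
    using reg inf unfolding regular_foils_def foil_eq[OF y x, symmetric] by blast+
qed (use foil_less_irrefl foil_less_trans in blast)+

section \<open>The successor shift is dense and preserves the order\<close>

definition foil_succ :: "('a::euclidean_space set \<Rightarrow> 'a) \<Rightarrow> 'a set \<Rightarrow> 'a \<Rightarrow> 'a \<Rightarrow> bool" where
  "foil_succ f \<phi> x y \<longleftrightarrow> y \<in> foil f \<phi> x \<and> cyclic_succ (foil f \<phi> x) (foil_less f \<phi>) x y"

lemma inv_into_funpow:
  assumes "bij_betw H A A" "x \<in> A"
  shows "(inv_into A H ^^ n) ((H ^^ n) x) = x"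
  using assms(2)
proof (induction n arbitrary: x)
  case (Suc n)
  have "(H ^^ n) x \<in> A" by (rule funpow_mem) (use assms Suc in \<open>auto simp: bij_betw_def\<close>)
  then have "inv_into A H (H ((H ^^ n) x)) = (H ^^ n) x"
    using assms(1) by (simp add: bij_betw_def inv_into_f_f)
  then have "(inv_into A H ^^ Suc n) ((H ^^ Suc n) x) = (inv_into A H ^^ n) ((H ^^ n) x)"
    by (simp add: funpow_swap1 del: funpow.simps(2)) (simp add: funpow_swap1)
  then show ?case using Suc by simp
qed simp

text \<open>In the following \<open>h\<close> is any function whose point-shift follows the successor relation of the foils
  of one configuration with regular foils.\<close>

context
  fixes f h :: "'a::euclidean_space set \<Rightarrow> 'a" and \<phi> :: "'a set"
  assumes F: "\<And>x. x \<in> \<phi> \<Longrightarrow> point_shift f \<phi> x \<in> \<phi>"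
    and reg: "regular_foils f \<phi>"
    and succ: "\<And>x. x \<in> \<phi> \<Longrightarrow> foil_succ f \<phi> x (point_shift h \<phi> x)"
begin

lemma succ_in_foil: "x \<in> \<phi> \<Longrightarrow> point_shift h \<phi> x \<in> foil f \<phi> x"
  using succ unfolding foil_succ_def by blast

lemma succ_pred_exists:
  assumes y: "y \<in> \<phi>"
  shows "\<exists>x\<in>foil f \<phi> y. point_shift h \<phi> x = y"
proof -
  interpret finite_or_integer_order "foil f \<phi> y" "foil_less f \<phi>"
    by (rule finite_or_integer_order_foil[OF F reg y])
  obtain x where x: "x \<in> foil f \<phi> y" "cyclic_succ (foil f \<phi> y) (foil_less f \<phi>) x y"
    using ex1_cyclic_pred[OF foil_refl[OF y]] by blast
  have "foil_succ f \<phi> x (point_shift h \<phi> x)" using succ x(1) foil_subset by blast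
  then have "point_shift h \<phi> x = y"
    using ex1_cyclic_succ[OF x(1)] x(2) foil_refl[OF y] unfolding foil_succ_def foil_eq[OF x(1) y]
    by blast
  with x show ?thesis by blast
qed

lemma succ_bij: "bij_betw (point_shift h \<phi>) \<phi> \<phi>"
proof (rule bij_betwI')
  show "point_shift h \<phi> x \<in> \<phi>" if "x \<in> \<phi>" for x
    using succ_in_foil[OF that] foil_subset by blast
  show "\<exists>x\<in>\<phi>. y = point_shift h \<phi> x" if "y \<in> \<phi>" for y
    using succ_pred_exists[OF that] foil_subset by blast
  fix x y assume x: "x \<in> \<phi>" and y: "y \<in> \<phi>"
  show "point_shift h \<phi> x = point_shift h \<phi> y \<longleftrightarrow> x = y"
  proof
    assume eq: "point_shift h \<phi> x = point_shift h \<phi> y"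
    let ?w = "point_shift h \<phi> x"
    have w: "?w \<in> \<phi>" "x \<in> foil f \<phi> ?w" "y \<in> foil f \<phi> ?w"
      using succ_in_foil[OF x] succ_in_foil[OF y] foil_sym x y foil_subset eq by auto blast
    interpret finite_or_integer_order "foil f \<phi> ?w" "foil_less f \<phi>"
      by (rule finite_or_integer_order_foil[OF F reg w(1)])
    have "cyclic_succ (foil f \<phi> ?w) (foil_less f \<phi>) x ?w" "cyclic_succ (foil f \<phi> ?w) (foil_less f \<phi>) y ?w"
      using succ[OF x] succ[OF y] foil_eq[OF w(2,1)] foil_eq[OF w(3,1)] eq
      unfolding foil_succ_def by simp_all
    then show "x = y" using ex1_cyclic_pred[OF foil_refl[OF w(1)]] w by blast
  qed simp
qed

lemma succ_foil_stable: "foil_stable f h \<phi>"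
  unfolding foil_stable_def
proof (intro conjI ballI succ_bij)
  fix x assume x: "x \<in> \<phi>"
  show "point_shift h \<phi> ` foil f \<phi> x = foil f \<phi> x"
  proof (intro equalityI subsetI)
    fix y assume "y \<in> point_shift h \<phi> ` foil f \<phi> x"
    then obtain w where w: "w \<in> foil f \<phi> x" "y = point_shift h \<phi> w" by blast
    then show "y \<in> foil f \<phi> x" using succ_in_foil[of w] foil_subset foil_trans by blast
  next
    fix y assume y: "y \<in> foil f \<phi> x"
    then show "y \<in> point_shift h \<phi> ` foil f \<phi> x"
      using succ_pred_exists[of y] foil_subset foil_trans by blast
  qed
qed

lemma succ_reaches:
  assumes x: "x \<in> \<phi>" and y: "y \<in> foil f \<phi> x" and "foil_less f \<phi> x y"
  shows "\<exists>i. (point_shift h \<phi> ^^ i) x = y"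
proof -
  interpret finite_or_integer_order "foil f \<phi> x" "foil_less f \<phi>"
    by (rule finite_or_integer_order_foil[OF F reg x])
  show ?thesis
  proof (rule cyclic_succ_reaches)
    fix z assume z: "z \<in> foil f \<phi> x"
    then have "foil_succ f \<phi> z (point_shift h \<phi> z)" using succ foil_subset by blast
    then show "point_shift h \<phi> z \<in> foil f \<phi> x \<and>
        cyclic_succ (foil f \<phi> x) (foil_less f \<phi>) z (point_shift h \<phi> z)"
      unfolding foil_succ_def foil_eq[OF z x] .
  qed (use assms foil_refl in auto)
qed

lemma succ_foil_dense: "foil_dense f h \<phi>"
  unfolding foil_dense_def
proof (intro ballI equalityI subsetI)
  let ?H = "point_shift h \<phi>"
  fix x y assume x: "x \<in> \<phi>"
  show "y \<in> foil f \<phi> x" if "y \<in> {int_iterate \<phi> ?H i x | i. True}"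
  proof -
    have H: "?H z \<in> foil f \<phi> x" if z: "z \<in> foil f \<phi> x" for z
      using succ_in_foil[of z] z foil_subset foil_trans by blast
    have inv: "inv_into \<phi> ?H z \<in> foil f \<phi> x" if z: "z \<in> foil f \<phi> x" for z
    proof -
      obtain w where w: "w \<in> foil f \<phi> z" "?H w = z" using succ_pred_exists z foil_subset by blast
      then have "inv_into \<phi> ?H z = w"
        using succ_bij foil_subset by (metis bij_betw_def inv_into_f_f subsetD)
      with foil_trans[OF z w(1)] show ?thesis by simp
    qed
    from that obtain i where "y = int_iterate \<phi> ?H i x" by blast
    then show ?thesis
      unfolding int_iterate_def using funpow_mem[of "foil f \<phi> x", OF H foil_refl[OF x]]
        funpow_mem[of "foil f \<phi> x", OF inv foil_refl[OF x]]
      by (auto split: if_splits)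
  qed
  show "y \<in> {int_iterate \<phi> ?H i x | i. True}" if y: "y \<in> foil f \<phi> x"
  proof -
    consider "x = y" | "foil_less f \<phi> x y" | "foil_less f \<phi> y x"
      using foil_less_total[OF y] by blast
    then have "\<exists>i. y = int_iterate \<phi> ?H i x"
    proof cases
      case 1
      then have "y = int_iterate \<phi> ?H 0 x" by (simp add: int_iterate_def)
      then show ?thesis ..
    next
      case 2
      then obtain n where "(?H ^^ n) x = y" using succ_reaches[OF x y] by blast
      then have "y = int_iterate \<phi> ?H (int n) x" by (simp add: int_iterate_def)
      then show ?thesis ..
    next
      case 3
      have y': "y \<in> \<phi>" using y foil_subset by blast
      obtain n where n: "(?H ^^ n) y = x" using succ_reaches[OF y' foil_sym[OF y x] 3] by blast
      have "(inv_into \<phi> ?H ^^ n) x = y"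
        unfolding n[symmetric] by (rule inv_into_funpow[OF succ_bij y'])
      then have "y = int_iterate \<phi> ?H (- int n) x" using n by (auto simp: int_iterate_def)
      then show ?thesis ..
    qed
    then show ?thesis by blast
  qed
qed

text \<open>On an infinite foil the successor is strictly larger, as there is no greatest point to return from.
  So, on it, \<open>shift_le h \<phi>\<close> is the reflexive closure of \<open>foil_less f \<phi>\<close>, which \<open>F\<close> preserves. In
  the foil of \<open>F x\<close>, larger points are reached by forward iteration.\<close>

lemma succ_foil_order_preserving: "foil_order_preserving f h \<phi>"
  unfolding foil_order_preserving_def
proof (intro ballI impI)
  let ?F = "point_shift f \<phi>" and ?H = "point_shift h \<phi>"
  fix c x y
  assume inf: "\<forall>z\<in>shift_component f \<phi> c. infinite (foil f \<phi> z)"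
    and x: "x \<in> shift_component f \<phi> c" and y: "y \<in> foil f \<phi> x" and le: "shift_le h \<phi> x y"
  have x': "x \<in> \<phi>" using x by (simp add: shift_component_def)
  have less_H: "foil_less f \<phi> z (?H z)" if z: "z \<in> foil f \<phi> x" for z
  proof -
    interpret finite_or_integer_order "foil f \<phi> x" "foil_less f \<phi>"
      by (rule finite_or_integer_order_foil[OF F reg x'])
    have "\<exists>w\<in>foil f \<phi> x. foil_less f \<phi> z w" using no_max inf x z by blast
    moreover have "foil_succ f \<phi> z (?H z)" using succ z foil_subset by blast
    ultimately show ?thesis unfolding foil_succ_def foil_eq[OF z x'] cyclic_succ_def by blast
  qed
  have iter: "(?H ^^ i) x \<in> foil f \<phi> x \<and> ((?H ^^ i) x = x \<or> foil_less f \<phi> x ((?H ^^ i) x))" for i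
  proof (induction i)
    case 0
    then show ?case using foil_refl[OF x'] by simp
  next
    case (Suc i)
    let ?z = "(?H ^^ i) x"
    have z: "?z \<in> foil f \<phi> x" using Suc by blast
    then have "?H ?z \<in> foil f \<phi> ?z" using succ_in_foil foil_subset by blast
    then have "?H ?z \<in> foil f \<phi> x" by (rule foil_trans[OF z])
    moreover have "foil_less f \<phi> x (?H ?z)"
      using Suc less_H[OF z] foil_less_trans by metis
    ultimately show ?case by simp
  qed
  obtain i where "y = (?H ^^ i) x" using le unfolding shift_le_def by blast
  then have "?F x = ?F y \<or> foil_less f \<phi> (?F x) (?F y)"
    using iter[of i] foil_less_shift[of f \<phi> x y] by metis
  then show "shift_le h \<phi> (?F x) (?F y)"
  proof
    assume "?F x = ?F y"
    then have "?F y = (?H ^^ 0) (?F x)" by simp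
    then show ?thesis unfolding shift_le_def ..
  next
    assume less: "foil_less f \<phi> (?F x) (?F y)"
    have "?F y \<in> foil f \<phi> (?F x)"
    proof -
      obtain n where "(?F ^^ n) x = (?F ^^ n) y" using y unfolding foil_def by blast
      then have "(?F ^^ n) (?F x) = (?F ^^ n) (?F y)" by (simp flip: funpow_swap1)
      moreover have "?F y \<in> \<phi>" using F y foil_subset by blast
      ultimately show ?thesis unfolding foil_def by blast
    qed
    from succ_reaches[OF F[OF x'] this less] show ?thesis unfolding shift_le_def by metis
  qed
qed

end

lemma ex1_foil_succ:
  assumes F: "\<And>x. x \<in> \<phi> \<Longrightarrow> point_shift f \<phi> x \<in> \<phi>"
    and reg: "regular_foils f \<phi>" and x: "x \<in> \<phi>"
  shows "\<exists>!y. y \<in> \<phi> \<and> foil_succ f \<phi> x y"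
proof -
  interpret finite_or_integer_order "foil f \<phi> x" "foil_less f \<phi>"
    by (rule finite_or_integer_order_foil[OF F reg x])
  show ?thesis
    using ex1_cyclic_succ[OF foil_refl[OF x]] foil_subset unfolding foil_succ_def by blast
qed

section \<open>Measurability and translation invariance of the foil order\<close>

lemma measurable_point_shift [measurable (raw)]:
  assumes [measurable]: "f \<in> borel_measurable configs" "g \<in> measurable M configs" "t \<in> borel_measurable M"
  shows "(\<lambda>w. point_shift f (g w) (t w)) \<in> borel_measurable M"
  unfolding point_shift_def by measurable

lemma measurable_point_shift_iterate [measurable (raw)]:
  assumes [measurable]: "f \<in> borel_measurable configs" "g \<in> measurable M configs" "t \<in> borel_measurable M"
  shows "(\<lambda>w. (point_shift f (g w) ^^ n) (t w)) \<in> borel_measurable M"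
  by (induction n) (simp_all, measurable)

lemma measurable_lex_less [measurable (raw)]:
  assumes [measurable]: "s \<in> borel_measurable M" "t \<in> borel_measurable M"
  shows "Measurable.pred M (\<lambda>w. lex_less (s w) (t w))"
  unfolding lex_less_def by measurable

lemma measurable_foil [measurable (raw)]:
  assumes [measurable]: "f \<in> borel_measurable configs" "g \<in> measurable M configs"
    "s \<in> borel_measurable M" "t \<in> borel_measurable M"
  shows "Measurable.pred M (\<lambda>w. t w \<in> foil f (g w) (s w))"
  unfolding foil_def mem_Collect_eq by measurable

lemma measurable_foil_less [measurable (raw)]:
  assumes [measurable]: "f \<in> borel_measurable configs" "g \<in> measurable M configs"
    "s \<in> borel_measurable M" "t \<in> borel_measurable M"
  shows "Measurable.pred M (\<lambda>w. foil_less f (g w) (s w) (t w))"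
  unfolding foil_less_def by measurable

lemma measurable_Bex_foil:
  assumes [measurable]: "f \<in> borel_measurable configs" "g \<in> measurable M configs" "s \<in> borel_measurable M"
    and [measurable]: "Measurable.pred (M \<Otimes>\<^sub>M borel) (\<lambda>p. P (fst p) (snd p))"
  shows "Measurable.pred M (\<lambda>w. \<exists>x\<in>foil f (g w) (s w). P w x)"
proof -
  have "(\<exists>x\<in>foil f (g w) (s w). P w x) \<longleftrightarrow> (\<exists>x\<in>g w. x \<in> foil f (g w) (s w) \<and> P w x)" for w
    using foil_subset by blast
  moreover have "Measurable.pred M (\<lambda>w. \<exists>x\<in>g w. x \<in> foil f (g w) (s w) \<and> P w x)"
    by (rule measurable_Bex_points) measurable
  ultimately show ?thesis by simp
qed

lemma measurable_foil_succ [measurable (raw)]: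
  assumes [measurable]: "f \<in> borel_measurable configs" "g \<in> measurable M configs"
    "s \<in> borel_measurable M" "t \<in> borel_measurable M"
  shows "Measurable.pred M (\<lambda>w. foil_succ f (g w) (s w) (t w))"
proof -
  have [measurable]: "Measurable.pred M (\<lambda>w. \<exists>z\<in>foil f (g w) (s w). foil_less f (g w) (s w) z \<and> foil_less f (g w) z (t w))"
    "Measurable.pred M (\<lambda>w. \<exists>z\<in>foil f (g w) (s w). foil_less f (g w) (s w) z)"
    "Measurable.pred M (\<lambda>w. \<exists>z\<in>foil f (g w) (s w). foil_less f (g w) z (t w))"
    by (rule measurable_Bex_foil; measurable)+
  show ?thesis unfolding foil_succ_def cyclic_succ_def by measurable
qed

lemma translate_translate: "translate s (translate t \<phi>) = translate (s + t) \<phi>"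
  unfolding translate_def image_image by (simp add: algebra_simps)

lemma mem_translate: "x - t \<in> translate t \<phi> \<longleftrightarrow> x \<in> \<phi>"
  unfolding translate_def by auto

lemma point_shift_translate:
  "point_shift f (translate t \<phi>) (x - t) = point_shift f \<phi> x - t"
  unfolding point_shift_def translate_translate by simp

lemma point_shift_iterate_translate:
  "(point_shift f (translate t \<phi>) ^^ n) (x - t) = (point_shift f \<phi> ^^ n) x - t"
  by (induction n) (simp_all add: point_shift_translate)

lemma foil_less_translate:
  "foil_less f (translate t \<phi>) (x - t) (y - t) = foil_less f \<phi> x y"
  unfolding foil_less_def point_shift_iterate_translate lex_less_diff by simp

lemma foil_translate:
  "foil f (translate t \<phi>) (x - t) = (\<lambda>y. y - t) ` foil f \<phi> x"
proof -
  have "y - t \<in> foil f (translate t \<phi>) (x - t) \<longleftrightarrow> y \<in> foil f \<phi> x" for y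
    unfolding foil_def mem_Collect_eq point_shift_iterate_translate mem_translate by simp
  then have "z \<in> foil f (translate t \<phi>) (x - t) \<longleftrightarrow> z + t \<in> foil f \<phi> x" for z
    by (metis add_diff_cancel_right')
  then show ?thesis by (force simp: image_iff)
qed

lemma foil_succ_translate:
  fixes x y t :: "'a::euclidean_space"
  shows "foil_succ f (translate t \<phi>) (x - t) (y - t) = foil_succ f \<phi> x y"
proof -
  have "y - t \<in> (\<lambda>y. y - t) ` A \<longleftrightarrow> y \<in> A" for A :: "'a set" by auto
  then show ?thesis
    unfolding foil_succ_def cyclic_succ_def foil_translate by (simp add: foil_less_translate)
qed

section \<open>Mass transport\<close>

definition lattice :: "'a::euclidean_space set" where
  "lattice = {z. \<forall>b\<in>Basis. z \<bullet> b \<in> \<int>}"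

definition unit_cube :: "'a::euclidean_space set" where
  "unit_cube = {x. \<forall>b\<in>Basis. 0 \<le> x \<bullet> b \<and> x \<bullet> b < 1}"

lemma unit_cube_borel [measurable]: "unit_cube \<in> sets borel"
proof -
  have "{x \<in> space borel. \<forall>b\<in>Basis. 0 \<le> x \<bullet> b \<and> x \<bullet> b < 1} \<in> sets borel"
    by measurable
  then show ?thesis unfolding unit_cube_def by simp
qed

lemma unit_cube_subset: "unit_cube \<subseteq> cbox 0 One"
  unfolding unit_cube_def by (auto simp: mem_box less_imp_le)

lemma lattice_representation:
  assumes "z \<in> lattice"
  obtains c where "c \<in> Basis \<rightarrow>\<^sub>E (UNIV :: int set)" "z = (\<Sum>b\<in>Basis. of_int (c b) *\<^sub>R b)"
    "\<And>b. b \<in> Basis \<Longrightarrow> z \<bullet> b = of_int (c b)"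
proof
  define c where "c = (\<lambda>b\<in>Basis. \<lfloor>z \<bullet> b\<rfloor>)"
  show "c \<in> Basis \<rightarrow>\<^sub>E UNIV" unfolding c_def by simp
  show c: "z \<bullet> b = of_int (c b)" if "b \<in> Basis" for b
    using assms that unfolding lattice_def c_def by simp
  show "z = (\<Sum>b\<in>Basis. of_int (c b) *\<^sub>R b)"
    using euclidean_representation[of z, symmetric] c by (simp cong: sum.cong)
qed

lemma countable_lattice: "countable (lattice :: 'a::euclidean_space set)"
proof -
  have "(lattice :: 'a set) \<subseteq> (\<lambda>c. \<Sum>b\<in>Basis. of_int (c b) *\<^sub>R b) ` (Basis \<rightarrow>\<^sub>E (UNIV :: int set))"
  proof
    fix z :: 'a assume "z \<in> lattice"
    then obtain c where "c \<in> Basis \<rightarrow>\<^sub>E (UNIV :: int set)" "z = (\<Sum>b\<in>Basis. of_int (c b) *\<^sub>R b)"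
      by (rule lattice_representation)
    then show "z \<in> (\<lambda>c. \<Sum>b\<in>Basis. of_int (c b) *\<^sub>R b) ` (Basis \<rightarrow>\<^sub>E (UNIV :: int set))" by blast
  qed
  moreover have "countable (Basis \<rightarrow>\<^sub>E (UNIV :: int set) :: ('a \<Rightarrow> int) set)"
    by (intro countable_PiE) auto
  ultimately show ?thesis by (meson countable_image countable_subset)
qed

lemma uminus_lattice: "z \<in> lattice \<Longrightarrow> - z \<in> lattice"
  unfolding lattice_def by simp

text \<open>The translates of the half-open unit cube by lattice vectors tile the space; the tile of a point is
  found by rounding its coordinates down.\<close>

lemma ex1_lattice_shift:
  "\<exists>!z. z \<in> lattice \<and> x - z \<in> unit_cube"
proof (rule ex1I)
  define z where "z = (\<Sum>b\<in>Basis. of_int \<lfloor>x \<bullet> b\<rfloor> *\<^sub>R b)"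
  have z: "z \<bullet> b = of_int \<lfloor>x \<bullet> b\<rfloor>" if "b \<in> Basis" for b
    unfolding z_def using that by (simp add: inner_sum_left inner_Basis if_distrib cong: if_cong)
  show "z \<in> lattice \<and> x - z \<in> unit_cube"
    unfolding lattice_def unit_cube_def using z by (auto simp: inner_diff_left) linarith+
  fix y assume y: "y \<in> lattice \<and> x - y \<in> unit_cube"
  show "y = z"
  proof (rule euclidean_eqI)
    fix b :: 'a assume b: "b \<in> Basis"
    then obtain k :: int where k: "y \<bullet> b = of_int k" using y unfolding lattice_def by (auto elim: Ints_cases)
    have "of_int k \<le> x \<bullet> b" "x \<bullet> b < of_int k + 1"
      using y b k unfolding unit_cube_def by (auto simp: inner_diff_left)
    then have "\<lfloor>x \<bullet> b\<rfloor> = k" by (simp add: floor_unique)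
    then show "y \<bullet> b = z \<bullet> b" using k z[OF b] by simp
  qed
qed

lemma lattice_tiling:
  "(\<integral>\<^sup>+z. indicator unit_cube (x - z) \<partial>count_space lattice) = 1"
proof -
  obtain z0 where z0: "z0 \<in> lattice" "x - z0 \<in> unit_cube"
      "\<And>z. z \<in> lattice \<Longrightarrow> x - z \<in> unit_cube \<Longrightarrow> z = z0"
    using ex1_lattice_shift[of x] by (elim ex1E) blast
  have "(\<integral>\<^sup>+z. indicator unit_cube (x - z) \<partial>count_space lattice) =
      (\<integral>\<^sup>+z. indicator {z0} z \<partial>count_space lattice)"
    using z0(1,2) by (intro nn_integral_cong) (auto simp: indicator_def dest: z0(3))
  also have "\<dots> = 1" using z0(1) by simp
  finally show ?thesis .
qed

lemma lattice_tiling':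
  "(\<integral>\<^sup>+z. indicator unit_cube (x + z) \<partial>count_space lattice) = 1"
proof -
  have "bij_betw uminus (lattice :: 'a set) lattice"
    by (rule bij_betw_byWitness[of _ uminus]) (auto intro: uminus_lattice)
  from nn_integral_bij_count_space[OF this, of "\<lambda>z. indicator unit_cube (x + z)"]
  show ?thesis using lattice_tiling[of x] by simp
qed

text \<open>The mass that \<open>x\<close> sends to \<open>y\<close> is 1 if \<open>R \<phi> x y\<close> and 0 otherwise. The weights \<open>a\<close> and \<open>b\<close> restrict
  the sources and the targets; typical weights are 1 and the indicator functions of translated unit cubes.\<close>

definition transport ::
    "('a set \<Rightarrow> 'a \<Rightarrow> 'a \<Rightarrow> bool) \<Rightarrow> 'a set \<Rightarrow> ('a \<Rightarrow> ennreal) \<Rightarrow> ('a \<Rightarrow> ennreal) \<Rightarrow> ennreal" where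
  "transport R \<phi> a b = (\<integral>\<^sup>+x. \<integral>\<^sup>+y. (if R \<phi> x y then a x * b y else 0) \<partial>count_space \<phi> \<partial>count_space \<phi>)"

lemma transport_translate:
  assumes "\<And>\<phi> t x y. R (translate t \<phi>) (x - t) (y - t) = R \<phi> x y"
  shows "transport R (translate t \<phi>) a b = transport R \<phi> (\<lambda>x. a (x - t)) (\<lambda>y. b (y - t))"
  unfolding transport_def
  by (simp flip: nn_integral_bij_count_space[OF bij_betw_translate] add: assms)

lemma transport_measurable:
  assumes R: "Measurable.pred (configs \<Otimes>\<^sub>M borel \<Otimes>\<^sub>M borel) (\<lambda>p. R (fst p) (fst (snd p)) (snd (snd p)))"
    and [measurable]: "a \<in> borel_measurable borel" "b \<in> borel_measurable borel"
      "g \<in> measurable M configs"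
  shows "(\<lambda>w. transport R (g w) a b) \<in> borel_measurable M"
proof -
  have R' [measurable (raw)]: "Measurable.pred N (\<lambda>w. R (k w) (s w) (t w))"
    if [measurable]: "k \<in> measurable N configs" "s \<in> borel_measurable N" "t \<in> borel_measurable N"
    for N :: "(('w \<times> 'a) \<times> 'a) measure" and k s t
  proof -
    have "(\<lambda>w. (k w, s w, t w)) \<in> measurable N (configs \<Otimes>\<^sub>M borel \<Otimes>\<^sub>M borel)" by measurable
    from measurable_compose[OF this R] show ?thesis by simp
  qed
  show ?thesis
    unfolding transport_def
    by (rule measurable_point_sum, measurable, rule measurable_point_sum) measurable
qed

lemma transport_tile_source:
  "transport R \<phi> (\<lambda>_. 1) b =
    (\<integral>\<^sup>+z. transport R \<phi> (\<lambda>x. indicator unit_cube (x - z)) b \<partial>count_space lattice)"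
proof -
  note swap = nn_integral_count_space_nn_integral[OF countable_lattice]
  have "(\<integral>\<^sup>+z. transport R \<phi> (\<lambda>x. indicator unit_cube (x - z)) b \<partial>count_space lattice) =
      (\<integral>\<^sup>+x. \<integral>\<^sup>+y. \<integral>\<^sup>+z. (if R \<phi> x y then indicator unit_cube (x - z) * b y else 0)
        \<partial>count_space lattice \<partial>count_space \<phi> \<partial>count_space \<phi>)"
    unfolding transport_def by (simp add: swap)
  also have "\<dots> = transport R \<phi> (\<lambda>_. 1) b"
    unfolding transport_def
    by (intro nn_integral_cong) (simp add: nn_integral_multc lattice_tiling)
  finally show ?thesis ..
qed

lemma transport_tile_target:
  "transport R \<phi> a (\<lambda>_. 1) =
    (\<integral>\<^sup>+z. transport R \<phi> a (\<lambda>y. indicator unit_cube (y + z)) \<partial>count_space lattice)"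
proof -
  note swap = nn_integral_count_space_nn_integral[OF countable_lattice]
  have "(\<integral>\<^sup>+z. transport R \<phi> a (\<lambda>y. indicator unit_cube (y + z)) \<partial>count_space lattice) =
      (\<integral>\<^sup>+x. \<integral>\<^sup>+y. \<integral>\<^sup>+z. (if R \<phi> x y then a x * indicator unit_cube (y + z) else 0)
        \<partial>count_space lattice \<partial>count_space \<phi> \<partial>count_space \<phi>)"
    unfolding transport_def by (simp add: swap)
  also have "\<dots> = transport R \<phi> a (\<lambda>_. 1)"
    unfolding transport_def
    by (intro nn_integral_cong) (simp add: nn_integral_cmult lattice_tiling')
  finally show ?thesis ..
qed

text \<open>Each point sends out mass at most 1.\<close>

lemma transport_functional_le:
  assumes "\<And>x y y'. x \<in> \<phi> \<Longrightarrow> y \<in> \<phi> \<Longrightarrow> y' \<in> \<phi> \<Longrightarrow> R \<phi> x y \<Longrightarrow> R \<phi> x y' \<Longrightarrow> y = y'"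
  shows "transport R \<phi> (indicator B) (\<lambda>_. 1) \<le> num_points \<phi> B"
  unfolding transport_def num_points_eq_nn_integral
proof (rule nn_integral_mono)
  fix x assume "x \<in> space (count_space \<phi>)"
  then have x: "x \<in> \<phi>" by simp
  show "(\<integral>\<^sup>+y. (if R \<phi> x y then indicator B x * 1 else 0) \<partial>count_space \<phi>) \<le> (indicator B x :: ennreal)"
  proof (cases "\<exists>y\<in>\<phi>. R \<phi> x y")
    case True
    then obtain y where y: "y \<in> \<phi>" "R \<phi> x y" by blast
    have "R \<phi> x z \<longleftrightarrow> z = y" if "z \<in> \<phi>" for z
      using assms[OF x that y(1) _ y(2)] y(2) by blast
    then have "(\<integral>\<^sup>+z. (if R \<phi> x z then indicator B x * 1 else 0) \<partial>count_space \<phi>) =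
        (\<integral>\<^sup>+z. indicator B x * indicator {y} z \<partial>count_space \<phi>)"
      by (intro nn_integral_cong) (simp add: indicator_def)
    also have "\<dots> = indicator B x"
      using y(1) by (simp add: nn_integral_cmult)
    finally show ?thesis by simp
  next
    case False
    then have "(\<integral>\<^sup>+y. (if R \<phi> x y then indicator B x * 1 else 0) \<partial>count_space \<phi>) =
        (\<integral>\<^sup>+z. 0 \<partial>count_space \<phi>)"
      by (intro nn_integral_cong) auto
    then show ?thesis by simp
  qed
qed

text \<open>Every member of the fibre of \<open>y\<close> contributes at least 1 to the transported mass.\<close>

lemma finite_fibre_of_transport:
  assumes "transport R \<phi> (\<lambda>_. 1) b \<noteq> \<infinity>" "y \<in> \<phi>" "b y = 1"
  shows "finite {x \<in> \<phi>. R \<phi> x y}"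
proof -
  have "emeasure (count_space UNIV) {x \<in> \<phi>. R \<phi> x y} =
      (\<integral>\<^sup>+x. indicator {x. R \<phi> x y} x \<partial>count_space \<phi>)"
    unfolding num_points_eq_nn_integral[symmetric] num_points_def by (simp add: Int_def)
  also have "\<dots> \<le> transport R \<phi> (\<lambda>_. 1) b"
    unfolding transport_def
  proof (rule nn_integral_mono)
    fix x
    have "(if R \<phi> x y then 1 * b y else 0)
        \<le> (\<integral>\<^sup>+y. (if R \<phi> x y then 1 * b y else 0) \<partial>count_space \<phi>)"
      by (rule nn_integral_ge_point[OF assms(2)])
    then show "indicator {x. R \<phi> x y} x
        \<le> (\<integral>\<^sup>+y. (if R \<phi> x y then 1 * b y else 0) \<partial>count_space \<phi>)"
      using assms(3) by (auto simp: indicator_def split: if_splits)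
  qed
  finally have "emeasure (count_space UNIV) {x \<in> \<phi>. R \<phi> x y} \<noteq> \<infinity>"
    using assms(1) by (auto simp: top_unique)
  then show ?thesis by (metis emeasure_count_space_infinite subset_UNIV infinity_ennreal_def)
qed

context stationary_point_process
begin

lemma nn_integral_translate_process:
  assumes "(\<lambda>\<omega>. u (\<Phi> \<omega>)) \<in> borel_measurable M"
  shows "(\<integral>\<^sup>+\<omega>. u (translate t (\<Phi> \<omega>)) \<partial>M) = (\<integral>\<^sup>+\<omega>. u (\<Phi> \<omega>) \<partial>M)"
proof -
  have "(\<integral>\<^sup>+\<omega>. u (translate t (\<Phi> \<omega>)) \<partial>M) = (\<integral>\<^sup>+\<omega>. u (\<Phi> (\<theta> t \<omega>)) \<partial>M)"
    by (intro nn_integral_cong) (simp add: process_equivariant)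
  also have "\<dots> = (\<integral>\<^sup>+\<omega>. u (\<Phi> \<omega>) \<partial>distr M M (\<theta> t))"
    by (rule nn_integral_distr[symmetric]) (use assms flow_measurable in auto)
  finally show ?thesis by (simp add: flow_invariant)
qed

lemma process_locally_finite: "\<omega> \<in> space M \<Longrightarrow> locally_finite_config (\<Phi> \<omega>)"
  using measurable_space[OF process_measurable] by (simp add: space_configs)

text \<open>Cut the space into the translates of the unit cube by lattice vectors. The mass sent into the unit
  cube from its translate by \<open>z\<close> has the same mean as the mass sent from the unit cube into its
  translate by \<open>-z\<close>. Summation over \<open>z\<close> gives the claim.\<close>

lemma mass_transport:
  assumes R [measurable]: "Measurable.pred (configs \<Otimes>\<^sub>M borel \<Otimes>\<^sub>M borel) (\<lambda>p. R (fst p) (fst (snd p)) (snd (snd p)))"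
    and inv: "\<And>\<phi> t x y. R (translate t \<phi>) (x - t) (y - t) = R \<phi> x y"
  shows "(\<integral>\<^sup>+\<omega>. transport R (\<Phi> \<omega>) (\<lambda>_. 1) (indicator unit_cube) \<partial>M) =
    (\<integral>\<^sup>+\<omega>. transport R (\<Phi> \<omega>) (indicator unit_cube) (\<lambda>_. 1) \<partial>M)"
proof -
  note swap = nn_integral_count_space_nn_integral[OF countable_lattice]
  have meas: "(\<lambda>\<omega>. transport R (\<Phi> \<omega>) a b) \<in> borel_measurable M"
    if "a \<in> borel_measurable borel" "b \<in> borel_measurable borel" for a b
    using R that process_measurable by (rule transport_measurable)
  have "(\<integral>\<^sup>+\<omega>. transport R (\<Phi> \<omega>) (\<lambda>_. 1) (indicator unit_cube) \<partial>M) =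
      (\<integral>\<^sup>+\<omega>. \<integral>\<^sup>+z. transport R (\<Phi> \<omega>) (\<lambda>x. indicator unit_cube (x - z)) (indicator unit_cube)
        \<partial>count_space lattice \<partial>M)"
    by (intro nn_integral_cong transport_tile_source)
  also have "\<dots> = (\<integral>\<^sup>+z. \<integral>\<^sup>+\<omega>. transport R (\<Phi> \<omega>) (\<lambda>x. indicator unit_cube (x - z)) (indicator unit_cube)
        \<partial>M \<partial>count_space lattice)"
    by (rule swap) (rule meas; measurable)
  also have "\<dots> = (\<integral>\<^sup>+z. \<integral>\<^sup>+\<omega>. transport R (translate z (\<Phi> \<omega>)) (indicator unit_cube)
        (\<lambda>y. indicator unit_cube (y + z)) \<partial>M \<partial>count_space lattice)"
    by (simp add: transport_translate[of R, OF inv])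
  also have "\<dots> = (\<integral>\<^sup>+z. \<integral>\<^sup>+\<omega>. transport R (\<Phi> \<omega>) (indicator unit_cube)
        (\<lambda>y. indicator unit_cube (y + z)) \<partial>M \<partial>count_space lattice)"
    by (intro nn_integral_cong nn_integral_translate_process meas) measurable
  also have "\<dots> = (\<integral>\<^sup>+\<omega>. \<integral>\<^sup>+z. transport R (\<Phi> \<omega>) (indicator unit_cube)
        (\<lambda>y. indicator unit_cube (y + z)) \<partial>count_space lattice \<partial>M)"
    by (rule swap[symmetric]) (rule meas; measurable)
  also have "\<dots> = (\<integral>\<^sup>+\<omega>. transport R (\<Phi> \<omega>) (indicator unit_cube) (\<lambda>_. 1) \<partial>M)"
    by (intro nn_integral_cong transport_tile_target[symmetric])
  finally show ?thesis .
qed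

text \<open>The mass sent out of the unit cube has mean at most the intensity, so the mass received in the unit
  cube is almost surely finite. By stationarity the same holds in every lattice translate of the
  cube.\<close>

lemma AE_finite_fibres:
  assumes fin: "intensity M \<Phi> < \<infinity>"
    and R [measurable]: "Measurable.pred (configs \<Otimes>\<^sub>M borel \<Otimes>\<^sub>M borel) (\<lambda>p. R (fst p) (fst (snd p)) (snd (snd p)))"
    and inv: "\<And>\<phi> t x y. R (translate t \<phi>) (x - t) (y - t) = R \<phi> x y"
    and functional: "\<And>\<omega> x y y'. \<omega> \<in> space M \<Longrightarrow> x \<in> \<Phi> \<omega> \<Longrightarrow> y \<in> \<Phi> \<omega> \<Longrightarrow> y' \<in> \<Phi> \<omega> \<Longrightarrow>
        R (\<Phi> \<omega>) x y \<Longrightarrow> R (\<Phi> \<omega>) x y' \<Longrightarrow> y = y'"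
  shows "AE \<omega> in M. \<forall>y\<in>\<Phi> \<omega>. finite {x \<in> \<Phi> \<omega>. R (\<Phi> \<omega>) x y}"
proof -
  have meas: "(\<lambda>\<omega>. transport R (\<Phi> \<omega>) a b) \<in> borel_measurable M"
    if "a \<in> borel_measurable borel" "b \<in> borel_measurable borel" for a b
    using R that process_measurable by (rule transport_measurable)
  have "(\<integral>\<^sup>+\<omega>. transport R (\<Phi> \<omega>) (\<lambda>_. 1) (indicator unit_cube) \<partial>M) =
      (\<integral>\<^sup>+\<omega>. transport R (\<Phi> \<omega>) (indicator unit_cube) (\<lambda>_. 1) \<partial>M)"
    by (rule mass_transport[OF R inv])
  also have "\<dots> \<le> (\<integral>\<^sup>+\<omega>. num_points (\<Phi> \<omega>) unit_cube \<partial>M)"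
    by (intro nn_integral_mono transport_functional_le functional)
  also have "\<dots> \<le> intensity M \<Phi>"
    unfolding intensity_def num_points_def
    by (intro nn_integral_mono emeasure_mono) (use unit_cube_subset in auto)
  finally have base: "(\<integral>\<^sup>+\<omega>. transport R (\<Phi> \<omega>) (\<lambda>_. 1) (indicator unit_cube) \<partial>M) \<noteq> \<infinity>"
    using fin by auto
  have "AE \<omega> in M. \<forall>z\<in>lattice. transport R (\<Phi> \<omega>) (\<lambda>_. 1) (\<lambda>y. indicator unit_cube (y - z)) \<noteq> \<infinity>"
    unfolding AE_ball_countable[OF countable_lattice]
  proof
    fix z :: 'a
    have "(\<integral>\<^sup>+\<omega>. transport R (\<Phi> \<omega>) (\<lambda>_. 1) (\<lambda>y. indicator unit_cube (y - z)) \<partial>M) =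
        (\<integral>\<^sup>+\<omega>. transport R (translate z (\<Phi> \<omega>)) (\<lambda>_. 1) (indicator unit_cube) \<partial>M)"
      by (simp add: transport_translate[of R, OF inv])
    also have "\<dots> = (\<integral>\<^sup>+\<omega>. transport R (\<Phi> \<omega>) (\<lambda>_. 1) (indicator unit_cube) \<partial>M)"
      by (intro nn_integral_translate_process meas) measurable
    finally show "AE \<omega> in M. transport R (\<Phi> \<omega>) (\<lambda>_. 1) (\<lambda>y. indicator unit_cube (y - z)) \<noteq> \<infinity>"
      using base by (intro nn_integral_noteq_infinite meas) auto
  qed
  then show ?thesis
  proof eventually_elim
    case (elim \<omega>)
    show ?case
    proof
      fix y assume y: "y \<in> \<Phi> \<omega>"
      obtain z where "z \<in> lattice" "y - z \<in> unit_cube" using ex1_lattice_shift by blast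
      then show "finite {x \<in> \<Phi> \<omega>. R (\<Phi> \<omega>) x y}"
        using elim y by (intro finite_fibre_of_transport[of R _ "\<lambda>y. indicator unit_cube (y - z)"]) auto
    qed
  qed
qed

end

section \<open>Existence of the dense order-preserving point-shift\<close>

context stationary_point_process
begin

text \<open>All three relations to which \<open>AE_finite_fibres\<close> is applied send a point to at most one point: to its
  \<open>n\<close>-th iterate, to the least point of its foil (\<open>first\<close>), and to the greatest one (\<open>last\<close>). In the
  last two cases the fibre of an endpoint is the whole foil.\<close>

lemma AE_regular_foils:
  assumes fin: "intensity M \<Phi> < \<infinity>" and f [measurable]: "f \<in> borel_measurable configs"
  shows "AE \<omega> in M. regular_foils f (\<Phi> \<omega>)"
proof -
  define first where "first \<phi> x y \<longleftrightarrow> y \<in> foil f \<phi> x \<and> \<not> (\<exists>z\<in>foil f \<phi> x. foil_less f \<phi> z y)" for \<phi> x y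
  define last where "last \<phi> x y \<longleftrightarrow> y \<in> foil f \<phi> x \<and> \<not> (\<exists>z\<in>foil f \<phi> x. foil_less f \<phi> y z)" for \<phi> x y
  have same_foil: "z \<in> foil f \<phi> y" if "x \<in> \<phi>" "y \<in> foil f \<phi> x" "z \<in> foil f \<phi> x" for x y z \<phi>
    using foil_trans[OF foil_sym[OF that(2,1)] that(3)] .
  have "AE \<omega> in M. \<forall>n. \<forall>y\<in>\<Phi> \<omega>. finite {x \<in> \<Phi> \<omega>. (point_shift f (\<Phi> \<omega>) ^^ n) x = y}"
    unfolding AE_all_countable
  proof
    fix n
    show "AE \<omega> in M. \<forall>y\<in>\<Phi> \<omega>. finite {x \<in> \<Phi> \<omega>. (point_shift f (\<Phi> \<omega>) ^^ n) x = y}"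
      by (rule AE_finite_fibres[where R = "\<lambda>\<phi> x y. (point_shift f \<phi> ^^ n) x = y", OF fin])
        (auto simp: point_shift_iterate_translate)
  qed
  moreover have "AE \<omega> in M. \<forall>y\<in>\<Phi> \<omega>. finite {x \<in> \<Phi> \<omega>. first (\<Phi> \<omega>) x y}"
  proof (rule AE_finite_fibres[where R = first, OF fin])
    have [measurable]: "Measurable.pred (configs \<Otimes>\<^sub>M borel \<Otimes>\<^sub>M borel)
        (\<lambda>p. \<exists>z\<in>foil f (fst p) (fst (snd p)). foil_less f (fst p) z (snd (snd p)))"
      by (rule measurable_Bex_foil) measurable
    show "Measurable.pred (configs \<Otimes>\<^sub>M borel \<Otimes>\<^sub>M borel) (\<lambda>p. first (fst p) (fst (snd p)) (snd (snd p)))"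
      unfolding first_def by measurable
    show "first (translate t \<phi>) (x - t) (y - t) = first \<phi> x y" for \<phi> t x y
    proof -
      have "y - t \<in> (\<lambda>y. y - t) ` A \<longleftrightarrow> y \<in> A" for A by auto
      then show ?thesis unfolding first_def foil_translate by (simp add: foil_less_translate)
    qed
    fix \<omega> x y y'
    assume "\<omega> \<in> space M" and x: "x \<in> \<Phi> \<omega>" and "first (\<Phi> \<omega>) x y" "first (\<Phi> \<omega>) x y'"
    then show "y = y'"
      using same_foil[OF x] foil_less_total unfolding first_def by blast
  qed
  moreover have "AE \<omega> in M. \<forall>y\<in>\<Phi> \<omega>. finite {x \<in> \<Phi> \<omega>. last (\<Phi> \<omega>) x y}"
  proof (rule AE_finite_fibres[where R = last, OF fin])
    have [measurable]: "Measurable.pred (configs \<Otimes>\<^sub>M borel \<Otimes>\<^sub>M borel)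
        (\<lambda>p. \<exists>z\<in>foil f (fst p) (fst (snd p)). foil_less f (fst p) (snd (snd p)) z)"
      by (rule measurable_Bex_foil) measurable
    show "Measurable.pred (configs \<Otimes>\<^sub>M borel \<Otimes>\<^sub>M borel) (\<lambda>p. last (fst p) (fst (snd p)) (snd (snd p)))"
      unfolding last_def by measurable
    show "last (translate t \<phi>) (x - t) (y - t) = last \<phi> x y" for \<phi> t x y
    proof -
      have "y - t \<in> (\<lambda>y. y - t) ` A \<longleftrightarrow> y \<in> A" for A by auto
      then show ?thesis unfolding last_def foil_translate by (simp add: foil_less_translate)
    qed
    fix \<omega> x y y'
    assume "\<omega> \<in> space M" and x: "x \<in> \<Phi> \<omega>" and "last (\<Phi> \<omega>) x y" "last (\<Phi> \<omega>) x y'"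
    then show "y = y'"
      using same_foil[OF x] foil_less_total unfolding last_def by blast
  qed
  ultimately show ?thesis
  proof eventually_elim
    case (elim \<omega>)
    let ?L = "foil f (\<Phi> \<omega>)"
    have "(\<exists>y\<in>?L x. foil_less f (\<Phi> \<omega>) x y) \<and> (\<exists>y\<in>?L x. foil_less f (\<Phi> \<omega>) y x)"
      if x: "x \<in> \<Phi> \<omega>" and inf: "infinite (?L x)" for x
    proof (intro conjI; rule ccontr)
      assume "\<not> (\<exists>y\<in>?L x. foil_less f (\<Phi> \<omega>) y x)"
      then have "?L x \<subseteq> {w \<in> \<Phi> \<omega>. first (\<Phi> \<omega>) w x}"
        using foil_eq[OF _ x] foil_refl[OF x] foil_subset unfolding first_def by blast
      then show False using elim x inf finite_subset by blast
    next
      assume "\<not> (\<exists>y\<in>?L x. foil_less f (\<Phi> \<omega>) x y)"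
      then have "?L x \<subseteq> {w \<in> \<Phi> \<omega>. last (\<Phi> \<omega>) w x}"
        using foil_eq[OF _ x] foil_refl[OF x] foil_subset unfolding last_def by blast
      then show False using elim x inf finite_subset by blast
    qed
    then show ?case using elim(1) unfolding regular_foils_def by blast
  qed
qed

end

text \<open>A point-map is measurable only on the configurations with a point at the origin. Its extension by 0
  is measurable everywhere, and its point-shift agrees with the original one at the points of the
  configuration, so that foils, components and all properties in question are the same.\<close>

definition extend_point_map :: "('a::euclidean_space set \<Rightarrow> 'a) \<Rightarrow> 'a set \<Rightarrow> 'a" where
  "extend_point_map f \<phi> = (if 0 \<in> \<phi> then f \<phi> else 0)"

lemma extend_point_map_measurable:
  fixes f :: "'a::euclidean_space set \<Rightarrow> 'a"
  assumes "point_map f"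
  shows "extend_point_map f \<in> borel_measurable configs"
proof -
  have meas: "{\<phi> \<in> space configs. (0 :: 'a) \<in> \<phi>} \<in> sets configs" by measurable
  show ?thesis
    unfolding extend_point_map_def[abs_def] measurable_If_restrict_space_iff[OF meas]
    using assms by (simp add: point_map_def configs0_def)
qed

lemma point_shift_extend:
  assumes "x \<in> \<phi>"
  shows "point_shift (extend_point_map f) \<phi> x = point_shift f \<phi> x"
  using assms mem_translate[of x x \<phi>] by (simp add: point_shift_def extend_point_map_def)

lemma point_shift_mem:
  assumes "point_map f" "locally_finite_config \<phi>" "x \<in> \<phi>"
  shows "point_shift f \<phi> x \<in> \<phi>"
proof -
  have "translate x \<phi> \<in> space configs0"
    using assms mem_translate[of x x \<phi>] locally_finite_translate[of \<phi> x]
    by (simp add: configs0_def space_restrict_space space_configs)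
  then have "f (translate x \<phi>) \<in> translate x \<phi>"
    using assms(1) by (simp add: point_map_def)
  then show ?thesis
    using mem_translate[of "point_shift f \<phi> x" x \<phi>] by (simp add: point_shift_def)
qed

context
  fixes f h :: "'a::euclidean_space set \<Rightarrow> 'a" and \<phi> :: "'a set"
  assumes f: "point_map f" and \<phi>: "locally_finite_config \<phi>"
begin

lemma iterate_extend:
  assumes "x \<in> \<phi>"
  shows "(point_shift (extend_point_map f) \<phi> ^^ n) x = (point_shift f \<phi> ^^ n) x"
proof (induction n)
  case (Suc n)
  have "(point_shift f \<phi> ^^ n) x \<in> \<phi>"
    by (rule funpow_mem[OF point_shift_mem[OF f \<phi>] assms])
  then show ?case using Suc point_shift_extend by simp
qed simp

lemma foil_extend: "x \<in> \<phi> \<Longrightarrow> foil (extend_point_map f) \<phi> x = foil f \<phi> x"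
  unfolding foil_def using iterate_extend by auto

lemma shift_component_extend:
  "x \<in> \<phi> \<Longrightarrow> shift_component (extend_point_map f) \<phi> x = shift_component f \<phi> x"
  unfolding shift_component_def by (simp add: iterate_extend cong: conj_cong)

lemma foil_stable_extend: "foil_stable (extend_point_map f) h \<phi> = foil_stable f h \<phi>"
  unfolding foil_stable_def by (simp add: foil_extend)

lemma foil_dense_extend: "foil_dense (extend_point_map f) h \<phi> = foil_dense f h \<phi>"
  unfolding foil_dense_def by (simp add: foil_extend)

lemma foil_order_preserving_extend:
  "foil_order_preserving (extend_point_map f) h \<phi> = foil_order_preserving f h \<phi>"
proof -
  have "z \<in> \<phi>" if "z \<in> shift_component f \<phi> c" for z c
    using that by (simp add: shift_component_def)
  moreover have "y \<in> \<phi>" if "y \<in> foil f \<phi> x" for x y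
    using that by (simp add: foil_def)
  ultimately show ?thesis
    unfolding foil_order_preserving_def
    by (simp add: foil_extend shift_component_extend point_shift_extend cong: ball_cong)
qed

end

text \<open>The default 0 leaves a point where it is. It makes this a point-map on all configurations, also on
  those where a point has no successor or several.\<close>

definition succ_point_map :: "('a::euclidean_space set \<Rightarrow> 'a) \<Rightarrow> 'a set \<Rightarrow> 'a" where
  "succ_point_map f \<phi> = (if \<exists>!y. y \<in> \<phi> \<and> foil_succ f \<phi> 0 y
     then THE y. y \<in> \<phi> \<and> foil_succ f \<phi> 0 y else 0)"

lemma point_map_succ_point_map:
  assumes [measurable]: "f \<in> borel_measurable configs"
  shows "point_map (succ_point_map f)"
  unfolding point_map_def
proof (intro conjI ballI)
  have "succ_point_map f \<in> borel_measurable configs"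
    unfolding succ_point_map_def[abs_def] by (rule measurable_The_point) measurable
  then show "succ_point_map f \<in> borel_measurable configs0"
    unfolding configs0_def by (rule measurable_restrict_space1)
  fix \<phi> :: "'a set" assume "\<phi> \<in> space configs0"
  then have zero: "0 \<in> \<phi>" by (simp add: configs0_def space_restrict_space)
  show "succ_point_map f \<phi> \<in> \<phi>"
  proof (cases "\<exists>!y. y \<in> \<phi> \<and> foil_succ f \<phi> 0 y")
    case True
    from theI'[OF this] True show ?thesis unfolding succ_point_map_def by (simp only: if_True)
  next
    case False
    then show ?thesis unfolding succ_point_map_def by (simp only: if_False zero)
  qed
qed

text \<open>The successor of \<open>x\<close> is the successor of the origin seen from \<open>x\<close>, since the successor relation is
  translation invariant.\<close>

lemma foil_succ_point_shift:
  assumes "\<exists>!y. y \<in> \<phi> \<and> foil_succ f \<phi> x y"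
  shows "foil_succ f \<phi> x (point_shift (succ_point_map f) \<phi> x)"
proof -
  have eq: "v \<in> translate x \<phi> \<and> foil_succ f (translate x \<phi>) 0 v \<longleftrightarrow>
      v + x \<in> \<phi> \<and> foil_succ f \<phi> x (v + x)" for v
    using mem_translate[of "v + x" x \<phi>] foil_succ_translate[of f x \<phi> x "v + x"] by simp
  obtain y where y: "y \<in> \<phi> \<and> foil_succ f \<phi> x y" "\<And>z. z \<in> \<phi> \<and> foil_succ f \<phi> x z \<Longrightarrow> z = y"
    using assms by (elim ex1E) blast
  have ex1: "\<exists>!v. v \<in> translate x \<phi> \<and> foil_succ f (translate x \<phi>) 0 v"
    unfolding eq
  proof (rule ex1I)
    show "y - x + x \<in> \<phi> \<and> foil_succ f \<phi> x (y - x + x)" using y(1) by simp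
    fix v assume "v + x \<in> \<phi> \<and> foil_succ f \<phi> x (v + x)"
    from y(2)[OF this] show "v = y - x" by (simp add: eq_diff_eq)
  qed
  then have "succ_point_map f (translate x \<phi>) =
      (THE v. v \<in> translate x \<phi> \<and> foil_succ f (translate x \<phi>) 0 v)"
    unfolding succ_point_map_def by (simp only: if_True)
  with theI'[OF ex1] show ?thesis unfolding point_shift_def eq by simp
qed

theorem (in stationary_point_process) ex_dense_order_preserving_point_shift:
  assumes fin: "intensity M \<Phi> < \<infinity>" and f: "point_map f"
  shows "\<exists>h. point_map h \<and>
    (AE \<omega> in M. foil_stable f h (\<Phi> \<omega>)) \<and>
    (AE \<omega> in M. foil_dense f h (\<Phi> \<omega>)) \<and>
    (AE \<omega> in M. foil_order_preserving f h (\<Phi> \<omega>))"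
proof -
  let ?f = "extend_point_map f"
  let ?h = "succ_point_map ?f"
  have F: "point_shift ?f (\<Phi> \<omega>) x \<in> \<Phi> \<omega>" if "\<omega> \<in> space M" "x \<in> \<Phi> \<omega>" for \<omega> x
    using point_shift_mem[OF f process_locally_finite] that by (simp add: point_shift_extend)
  have f': "?f \<in> borel_measurable configs" by (rule extend_point_map_measurable[OF f])
  have "AE \<omega> in M. regular_foils ?f (\<Phi> \<omega>)"
    by (rule AE_regular_foils[OF fin f'])
  then have "AE \<omega> in M. foil_stable f ?h (\<Phi> \<omega>) \<and> foil_dense f ?h (\<Phi> \<omega>) \<and> foil_order_preserving f ?h (\<Phi> \<omega>)"
    using AE_space
  proof eventually_elim
    case (elim \<omega>)
    note F' = F[OF elim(2)] and lf = process_locally_finite[OF elim(2)]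
    have succ: "foil_succ ?f (\<Phi> \<omega>) x (point_shift ?h (\<Phi> \<omega>) x)" if "x \<in> \<Phi> \<omega>" for x
      by (rule foil_succ_point_shift[OF ex1_foil_succ[OF F' elim(1) that]])
    show ?case
      using succ_foil_stable[OF F' elim(1) succ] succ_foil_dense[OF F' elim(1) succ]
        succ_foil_order_preserving[OF F' elim(1) succ]
      by (simp add: foil_stable_extend[OF f lf] foil_dense_extend[OF f lf]
          foil_order_preserving_extend[OF f lf])
  qed
  then show ?thesis
    using point_map_succ_point_map[OF f'] by (intro exI[of _ ?h]) auto
qed

section \<open>Non-uniqueness\<close>

lemma three_cycle_stable_dense:
  assumes cyc: "\<And>x. x \<in> \<phi> \<Longrightarrow> point_shift g \<phi> (point_shift g \<phi> (point_shift g \<phi> x)) = x"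
    and foil: "\<And>x. x \<in> \<phi> \<Longrightarrow>
      foil f \<phi> x = {x, point_shift g \<phi> x, point_shift g \<phi> (point_shift g \<phi> x)}"
  shows "foil_stable f g \<phi> \<and> foil_dense f g \<phi> \<and> foil_order_preserving f g \<phi>"
proof (intro conjI)
  let ?H = "point_shift g \<phi>"
  have H: "?H x \<in> \<phi>" if "x \<in> \<phi>" for x
    using foil[OF that] foil_subset[of f \<phi> x] by blast
  have bij: "bij_betw ?H \<phi> \<phi>"
    by (rule bij_betw_byWitness[of _ "\<lambda>x. ?H (?H x)"]) (auto simp: cyc H)
  have image: "?H ` foil f \<phi> x = foil f \<phi> x" if "x \<in> \<phi>" for x
    using cyc[OF that] by (auto simp: foil[OF that])
  show "foil_stable f g \<phi>"
    unfolding foil_stable_def using bij image by blast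
  show "foil_dense f g \<phi>"
    unfolding foil_dense_def
  proof (intro ballI equalityI subsetI)
    fix x y assume x: "x \<in> \<phi>" and "y \<in> {int_iterate \<phi> ?H i x | i. True}"
    then obtain i where y: "y = int_iterate \<phi> ?H i x" by blast
    have closed: "?H w \<in> foil f \<phi> x" if "w \<in> foil f \<phi> x" for w
      using image[OF x] that by blast
    have inv: "inv_into \<phi> ?H w \<in> foil f \<phi> x" if w: "w \<in> foil f \<phi> x" for w
    proof -
      have w': "w \<in> \<phi>" using w foil_subset by blast
      have "inv_into \<phi> ?H (?H (?H (?H w))) = ?H (?H w)"
        using bij H[OF H[OF w']] by (simp add: bij_betw_def inv_into_f_f)
      then have "inv_into \<phi> ?H w = ?H (?H w)" by (simp add: cyc[OF w'])
      then show ?thesis using closed[OF closed[OF w]] by simp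
    qed
    show "y \<in> foil f \<phi> x"
      unfolding y int_iterate_def
      using funpow_mem[of "foil f \<phi> x", OF closed foil_refl[OF x]]
        funpow_mem[of "foil f \<phi> x", OF inv foil_refl[OF x]]
      by (auto split: if_splits)
  next
    fix x y assume x: "x \<in> \<phi>" and "y \<in> foil f \<phi> x"
    then have "y = (?H ^^ 0) x \<or> y = (?H ^^ 1) x \<or> y = (?H ^^ 2) x"
      by (auto simp: foil[OF x] numeral_2_eq_2)
    then obtain n where "y = (?H ^^ n) x" by blast
    then have "y = int_iterate \<phi> ?H (int n) x" by (simp add: int_iterate_def)
    then show "y \<in> {int_iterate \<phi> ?H i x | i. True}" by blast
  qed
  have "finite (foil f \<phi> x)" if "x \<in> \<phi>" for x
    by (simp add: foil[OF that])
  moreover have "c \<in> shift_component f \<phi> c" if "c \<in> \<phi>" for c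
    using that unfolding shift_component_def by blast
  ultimately show "foil_order_preserving f g \<phi>"
    unfolding foil_order_preserving_def by blast
qed

text \<open>The \<open>k\<close>-th multiple of a fifth of a fixed basis vector. With gaps of one fifth, the three points
  \<open>z + fifth 0\<close>, \<open>z + fifth 1\<close>, \<open>z + fifth 2\<close> belonging to a lattice vector \<open>z\<close> cannot be confused with
  those of a neighbouring one: a step of absolute value at most 2 leads from a point of one triple
  to a place between the triples or to the same triple, never to another triple.\<close>

definition fifth :: "int \<Rightarrow> 'a::euclidean_space" where
  "fifth k = (of_int k / 5) *\<^sub>R (SOME b. b \<in> Basis)"

definition triple_lattice :: "'a::euclidean_space set" where
  "triple_lattice = {z + fifth k | z k. z \<in> lattice \<and> k \<in> {0..2}}"

text \<open>The three point-maps of the example have this form. On a triple with the points 0, 1, 2,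
  \<open>jump (-2) (-1)\<close> sends all points to 0, \<open>jump 1 (-2)\<close> is the cycle from 0 to 1 to 2 to 0, and
  \<open>jump (-1) 2\<close> is the inverse cycle.\<close>

definition jump :: "int \<Rightarrow> int \<Rightarrow> 'a::euclidean_space set \<Rightarrow> 'a" where
  "jump i j \<phi> = (if fifth i \<in> \<phi> then fifth i else if fifth j \<in> \<phi> then fifth j else 0)"

lemma fifth_add: "fifth (i + j) = fifth i + fifth j"
  unfolding fifth_def by (simp add: add_divide_distrib scaleR_left_distrib)

lemma fifth_0: "fifth 0 = 0"
  by (simp add: fifth_def)

lemma lattice_fifth_unique:
  fixes z z' :: "'a::euclidean_space"
  assumes "z \<in> lattice" "z' \<in> lattice" "z + fifth i = z' + fifth j" "\<bar>i - j\<bar> < 5"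
  shows "z = z' \<and> i = j"
proof -
  define b :: 'a where "b = (SOME b. b \<in> Basis)"
  have b: "b \<in> Basis" unfolding b_def by (rule SOME_Basis)
  have "z \<bullet> b \<in> \<int>" "z' \<bullet> b \<in> \<int>" using assms(1,2) b unfolding lattice_def by auto
  then obtain m n :: int where mn: "z \<bullet> b = of_int m" "z' \<bullet> b = of_int n" by (auto elim!: Ints_cases)
  have "(z + fifth i) \<bullet> b = (z' + fifth j) \<bullet> b" using assms(3) by simp
  then have "real_of_int m + of_int i / 5 = of_int n + of_int j / 5"
    using b unfolding fifth_def b_def[symmetric] by (simp add: inner_add_left mn)
  then have "real_of_int (5 * m + i) = of_int (5 * n + j)" by (simp add: field_simps)
  then have "5 * m + i = 5 * n + j" by (simp only: of_int_eq_iff)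
  then have "i = j" using assms(4) by presburger
  then show ?thesis using assms(3) by simp
qed

lemma point_map_jump: "point_map (jump i j)"
proof -
  have "jump i j \<in> borel_measurable configs"
    unfolding jump_def[abs_def] by measurable
  then have "jump i j \<in> borel_measurable configs0"
    unfolding configs0_def by (rule measurable_restrict_space1)
  then show ?thesis
    unfolding point_map_def by (auto simp: jump_def configs0_def space_restrict_space)
qed

lemma point_shift_jump:
  assumes z: "z \<in> lattice" and k: "k \<in> {0..2}" and i: "i \<in> {-2..2}" and j: "j \<in> {-2..2}"
  shows "point_shift (jump i j) (translate u triple_lattice) (z + fifth k - u) =
    (if k + i \<in> {0..2} then z + fifth (k + i) - u
     else if k + j \<in> {0..2} then z + fifth (k + j) - u else z + fifth k - u)"
proof -
  have mem: "fifth l \<in> translate (z + fifth k - u) (translate u triple_lattice) \<longleftrightarrow> k + l \<in> {0..2}"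
    if l: "l \<in> {-2..2}" for l
  proof -
    have "fifth l \<in> translate (z + fifth k - u) (translate u triple_lattice) \<longleftrightarrow>
        z + fifth (k + l) \<in> triple_lattice"
      using mem_translate[of "z + fifth (k + l)" "z + fifth k" triple_lattice]
      by (simp add: translate_translate fifth_add)
    also have "\<dots> \<longleftrightarrow> k + l \<in> {0..2}"
    proof
      assume "z + fifth (k + l) \<in> triple_lattice"
      then obtain z' k' where *: "z' \<in> lattice" "k' \<in> {0..2}" "z + fifth (k + l) = z' + fifth k'"
        unfolding triple_lattice_def by blast
      have "\<bar>k + l - k'\<bar> < 5" using * k l by auto
      from lattice_fifth_unique[OF z *(1,3) this] *(2) show "k + l \<in> {0..2}" by simp
    qed (use z in \<open>auto simp: triple_lattice_def\<close>)
    finally show ?thesis .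
  qed
  show ?thesis
    unfolding point_shift_def jump_def mem[OF i] mem[OF j] by (simp add: fifth_add algebra_simps)
qed

lemma triple_lattice_jumps:
  fixes x u :: "'a::euclidean_space"
  assumes x: "x \<in> translate u triple_lattice" (is "x \<in> ?\<phi>")
    and g: "g = jump 1 (-2) \<or> g = jump (-1) 2"
  shows "point_shift g ?\<phi> (point_shift g ?\<phi> (point_shift g ?\<phi> x)) = x"
    and "foil (jump (-2) (-1)) ?\<phi> x = {x, point_shift g ?\<phi> x, point_shift g ?\<phi> (point_shift g ?\<phi> x)}"
    and "point_shift (jump 1 (-2)) ?\<phi> x \<noteq> point_shift (jump (-1) 2) ?\<phi> x"
proof -
  have rep: "\<exists>z k. z \<in> lattice \<and> k \<in> {0..2} \<and> y = z + fifth k - u" if "y \<in> ?\<phi>" for y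
    using that unfolding translate_def triple_lattice_def by blast
  obtain z k where z: "z \<in> lattice" and k: "k \<in> {0..2}" and x_eq: "x = z + fifth k - u"
    using rep[OF x] by blast
  define p where "p k = z + fifth k - u" for k
  have k3: "k = 0 \<or> k = 1 \<or> k = 2" using k by auto
  have G: "point_shift (jump 1 (-2)) ?\<phi> (p 0) = p 1" "point_shift (jump 1 (-2)) ?\<phi> (p 1) = p 2"
    "point_shift (jump 1 (-2)) ?\<phi> (p 2) = p 0" "point_shift (jump (-1) 2) ?\<phi> (p 0) = p 2"
    "point_shift (jump (-1) 2) ?\<phi> (p 1) = p 0" "point_shift (jump (-1) 2) ?\<phi> (p 2) = p 1"
    unfolding p_def by (simp_all add: point_shift_jump[OF z])
  have x_p: "x = p k" by (simp add: x_eq p_def)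
  show "point_shift g ?\<phi> (point_shift g ?\<phi> (point_shift g ?\<phi> x)) = x"
    using g k3 by (auto simp: x_p G)
  have F: "(point_shift (jump (-2) (-1)) ?\<phi> ^^ n) (w + fifth l - u) = (if n = 0 then w + fifth l - u else w - u)"
    if w: "w \<in> lattice" and l: "l \<in> {0..2}" for w l n
  proof (induction n)
    case (Suc n)
    have l3: "l = 0 \<or> l = 1 \<or> l = 2" using l by auto
    have "point_shift (jump (-2) (-1)) ?\<phi> (w + fifth l - u) = w - u"
      using point_shift_jump[OF w l, of "-2" "-1" u] l3 by (auto simp: fifth_0)
    moreover have "point_shift (jump (-2) (-1)) ?\<phi> (w - u) = w - u"
      using point_shift_jump[OF w, of 0 "-2" "-1" u] by (simp add: fifth_0)
    ultimately show ?case using Suc by simp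
  qed simp
  have pphi: "p l \<in> ?\<phi>" if "l \<in> {0..2}" for l
    using that z unfolding p_def translate_def triple_lattice_def by blast
  have "foil (jump (-2) (-1)) ?\<phi> x = {p 0, p 1, p 2}"
  proof (intro equalityI subsetI)
    fix y assume y: "y \<in> foil (jump (-2) (-1)) ?\<phi> x"
    then obtain w l n where w: "w \<in> lattice" and l: "l \<in> {0..2}" and y_eq: "y = w + fifth l - u"
      and n: "(point_shift (jump (-2) (-1)) ?\<phi> ^^ n) x = (point_shift (jump (-2) (-1)) ?\<phi> ^^ n) y"
      using rep unfolding foil_def by blast
    have "y = x \<or> w = z"
      using n unfolding x_eq y_eq F[OF z k] F[OF w l] by (auto split: if_splits)
    moreover have "l = 0 \<or> l = 1 \<or> l = 2" using l by auto
    ultimately show "y \<in> {p 0, p 1, p 2}"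
      using k3 by (auto simp: x_p y_eq p_def)
  next
    fix y assume "y \<in> {p 0, p 1, p 2}"
    then have "y \<in> p ` {0..2}" by auto
    then obtain l where l: "l \<in> {0..2}" "y = p l" by blast
    have "(point_shift (jump (-2) (-1)) ?\<phi> ^^ 1) x = (point_shift (jump (-2) (-1)) ?\<phi> ^^ 1) y"
      unfolding l(2) x_eq p_def F[OF z k] F[OF z l(1)] by simp
    then show "y \<in> foil (jump (-2) (-1)) ?\<phi> x"
      using pphi[OF l(1)] l(2) unfolding foil_def by blast
  qed
  also have "\<dots> = {x, point_shift g ?\<phi> x, point_shift g ?\<phi> (point_shift g ?\<phi> x)}"
    using g k3 by (auto simp: x_p G)
  finally show "foil (jump (-2) (-1)) ?\<phi> x = {x, point_shift g ?\<phi> x, point_shift g ?\<phi> (point_shift g ?\<phi> x)}" .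
  have "p i \<noteq> p j" if "i \<in> {0..2}" "j \<in> {0..2}" "i \<noteq> j" for i j
  proof
    assume "p i = p j"
    then have "z + fifth i = z + fifth j" by (simp add: p_def)
    moreover have "\<bar>i - j\<bar> < 5" using that(1,2) by auto
    ultimately show False using lattice_fifth_unique[OF z z] that(3) by blast
  qed
  from this[of 0 1] this[of 0 2] this[of 1 2]
  show "point_shift (jump 1 (-2)) ?\<phi> x \<noteq> point_shift (jump (-1) 2) ?\<phi> x"
    using k3 by (auto simp: x_p G)
qed

lemma finite_lattice_bounded:
  assumes "bounded (B :: 'a::euclidean_space set)"
  shows "finite (lattice \<inter> B)"
proof -
  obtain a where a: "B \<subseteq> cbox (- a) a" using bounded_subset_cbox_symmetric[OF assms] by blast
  let ?K = "Pi\<^sub>E Basis (\<lambda>b. {\<lceil>- (a \<bullet> b)\<rceil>..\<lfloor>a \<bullet> b\<rfloor>})"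
  have "lattice \<inter> B \<subseteq> (\<lambda>c. \<Sum>b\<in>Basis. of_int (c b) *\<^sub>R b) ` ?K"
  proof
    fix z assume z: "z \<in> lattice \<inter> B"
    then have "z \<in> lattice" by blast
    then obtain c where c: "c \<in> Basis \<rightarrow>\<^sub>E (UNIV :: int set)" "z = (\<Sum>b\<in>Basis. of_int (c b) *\<^sub>R b)"
      "\<And>b. b \<in> Basis \<Longrightarrow> z \<bullet> b = of_int (c b)"
      by (rule lattice_representation) (rule that)
    have "c b \<in> {\<lceil>- (a \<bullet> b)\<rceil>..\<lfloor>a \<bullet> b\<rfloor>}" if b: "b \<in> Basis" for b
    proof -
      have "- (a \<bullet> b) \<le> z \<bullet> b \<and> z \<bullet> b \<le> a \<bullet> b"
        using z a b by (auto simp: mem_box)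
      then show ?thesis using c(3)[OF b] by (simp add: ceiling_le_iff le_floor_iff)
    qed
    then have "c \<in> ?K" using c(1) by (auto simp: PiE_iff)
    then show "z \<in> (\<lambda>c. \<Sum>b\<in>Basis. of_int (c b) *\<^sub>R b) ` ?K" using c(2) by blast
  qed
  moreover have "finite ?K" by (intro finite_PiE) auto
  ultimately show ?thesis using finite_subset by blast
qed

lemma locally_finite_triple_lattice: "locally_finite_config (triple_lattice :: 'a::euclidean_space set)"
  unfolding locally_finite_config_def
proof (intro allI impI)
  fix B :: "'a set" assume B: "bounded B"
  have "finite (lattice \<inter> (\<lambda>x. - fifth k + x) ` B)" for k
    by (intro finite_lattice_bounded bounded_translation B)
  then have "finite (\<Union>k\<in>{0..2}. (\<lambda>z. z + fifth k) ` (lattice \<inter> (\<lambda>x. - fifth k + x) ` B))" by blast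
  moreover have "triple_lattice \<inter> B \<subseteq> (\<Union>k\<in>{0..2}. (\<lambda>z. z + fifth k) ` (lattice \<inter> (\<lambda>x. - fifth k + x) ` B))"
  proof
    fix x assume "x \<in> triple_lattice \<inter> B"
    then obtain z k where *: "z \<in> lattice" "k \<in> {0..2}" "x = z + fifth k" "x \<in> B"
      unfolding triple_lattice_def by blast
    then have "z = - fifth k + x" by simp
    with * show "x \<in> (\<Union>k\<in>{0..2}. (\<lambda>z. z + fifth k) ` (lattice \<inter> (\<lambda>x. - fifth k + x) ` B))" by blast
  qed
  ultimately show "finite (triple_lattice \<inter> B)" by (rule finite_subset[rotated])
qed

lemma translate_triple_lattice:
  fixes z :: "'a::euclidean_space"
  assumes "z \<in> lattice"
  shows "translate (u + z) triple_lattice = translate u triple_lattice"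
proof -
  have sub: "(\<lambda>x. x - w) ` triple_lattice \<subseteq> triple_lattice" if "w \<in> lattice" for w :: 'a
  proof
    fix y assume "y \<in> (\<lambda>x. x - w) ` triple_lattice"
    then obtain v k where *: "v \<in> lattice" "k \<in> {0..2}" "y = v + fifth k - w"
      unfolding triple_lattice_def by blast
    have "v - w \<in> lattice" using * that by (auto simp: lattice_def inner_diff_left)
    moreover have "y = (v - w) + fifth k" using * by simp
    ultimately show "y \<in> triple_lattice" using *(2) unfolding triple_lattice_def by blast
  qed
  have "translate z triple_lattice = triple_lattice"
  proof
    show "translate z triple_lattice \<subseteq> triple_lattice"
      unfolding translate_def by (rule sub[OF assms])
    show "triple_lattice \<subseteq> translate z triple_lattice"
    proof
      fix x :: 'a assume "x \<in> triple_lattice"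
      then have "x + z \<in> triple_lattice" using sub[OF uminus_lattice[OF assms]] by force
      then show "x \<in> translate z triple_lattice" using mem_translate[of "x + z" z triple_lattice] by simp
    qed
  qed
  then show ?thesis using translate_translate[of u z triple_lattice] by simp
qed

lemma emeasure_unit_cube: "emeasure lborel (unit_cube :: 'a::euclidean_space set) = 1"
proof (rule antisym)
  have "emeasure lborel (unit_cube :: 'a set) \<le> emeasure lborel (cbox 0 (One :: 'a))"
    by (rule emeasure_mono[OF unit_cube_subset]) simp
  then show "emeasure lborel (unit_cube :: 'a set) \<le> 1" by (simp add: emeasure_lborel_cbox_eq)
  have "emeasure lborel (box 0 (One :: 'a)) \<le> emeasure lborel (unit_cube :: 'a set)"
    by (rule emeasure_mono) (auto simp: unit_cube_def mem_box less_imp_le)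
  then show "1 \<le> emeasure lborel (unit_cube :: 'a set)" by (simp add: emeasure_lborel_box_eq)
qed

lemma nn_integral_lborel_translate:
  fixes g :: "'a::euclidean_space \<Rightarrow> ennreal"
  assumes [measurable]: "g \<in> borel_measurable borel"
  shows "(\<integral>\<^sup>+x. g (x + c) \<partial>lborel) = (\<integral>\<^sup>+x. g x \<partial>lborel)"
proof -
  have "(\<integral>\<^sup>+x. g x \<partial>lborel) = (\<integral>\<^sup>+x. g x \<partial>distr lborel borel ((+) c))"
    by (simp add: lborel_distr_plus)
  also have "\<dots> = (\<integral>\<^sup>+x. g (c + x) \<partial>lborel)"
    by (rule nn_integral_distr) measurable
  finally show ?thesis by (simp add: add.commute)
qed

text \<open>The unit cube and its translate by \<open>t\<close> are both fundamental domains of the lattice.\<close>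

lemma nn_integral_unit_cube_periodic:
  fixes g :: "'a::euclidean_space \<Rightarrow> ennreal"
  assumes [measurable]: "g \<in> borel_measurable borel"
    and periodic: "\<And>x z. z \<in> lattice \<Longrightarrow> g (x + z) = g x"
  shows "(\<integral>\<^sup>+x. g (x + t) * indicator unit_cube x \<partial>lborel) = (\<integral>\<^sup>+x. g x * indicator unit_cube x \<partial>lborel)"
proof -
  note swap = nn_integral_count_space_nn_integral[OF countable_lattice]
  have "(\<integral>\<^sup>+x. g (x + t) * indicator unit_cube x \<partial>lborel) =
      (\<integral>\<^sup>+x. g x * indicator unit_cube (x - t) \<partial>lborel)"
    using nn_integral_lborel_translate[of "\<lambda>x. g x * indicator unit_cube (x - t)" t] by simp
  also have "\<dots> = (\<integral>\<^sup>+x. \<integral>\<^sup>+z. g x * indicator unit_cube (x - t) * indicator unit_cube (x - z)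
      \<partial>count_space lattice \<partial>lborel)"
    by (simp add: nn_integral_cmult lattice_tiling)
  also have "\<dots> = (\<integral>\<^sup>+z. \<integral>\<^sup>+x. g x * indicator unit_cube (x - t) * indicator unit_cube (x - z)
      \<partial>lborel \<partial>count_space lattice)"
    by (rule swap) measurable
  also have "\<dots> = (\<integral>\<^sup>+z. \<integral>\<^sup>+x. g x * indicator unit_cube x * indicator unit_cube (x - t + z)
      \<partial>lborel \<partial>count_space lattice)"
  proof (rule nn_integral_cong)
    fix z :: 'a assume "z \<in> space (count_space lattice)"
    then have "g (x + z) = g x" for x using periodic by simp
    then show "(\<integral>\<^sup>+x. g x * indicator unit_cube (x - t) * indicator unit_cube (x - z) \<partial>lborel) =
        (\<integral>\<^sup>+x. g x * indicator unit_cube x * indicator unit_cube (x - t + z) \<partial>lborel)"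
      using nn_integral_lborel_translate[of "\<lambda>x. g x * indicator unit_cube (x - t) * indicator unit_cube (x - z)" z]
      by (simp add: algebra_simps)
  qed
  also have "\<dots> = (\<integral>\<^sup>+x. \<integral>\<^sup>+z. g x * indicator unit_cube x * indicator unit_cube (x - t + z)
      \<partial>count_space lattice \<partial>lborel)"
    by (rule swap[symmetric]) measurable
  also have "\<dots> = (\<integral>\<^sup>+x. g x * indicator unit_cube x \<partial>lborel)"
    by (simp add: nn_integral_cmult lattice_tiling')
  finally show ?thesis .
qed

text \<open>Confining the process to the translates of \<open>triple_lattice\<close> makes every property of these
  configurations hold at all points of the space, hence almost surely.\<close>

definition triple_space :: "'a::euclidean_space set measure" where
  "triple_space = restrict_space configs (range (\<lambda>u. translate u triple_lattice))"

definition shifted_triples :: "'a::euclidean_space set measure" where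
  "shifted_triples = distr (uniform_measure lborel unit_cube) triple_space (\<lambda>u. translate u triple_lattice)"

lemma measurable_shifted_triple:
  "(\<lambda>u. translate u triple_lattice) \<in> measurable borel triple_space"
  unfolding triple_space_def
proof (rule measurable_restrict_space2)
  have "triple_lattice \<in> space configs"
    by (simp add: space_configs locally_finite_triple_lattice)
  then show "(\<lambda>u. translate u triple_lattice) \<in> measurable borel configs" by measurable
qed simp

lemma space_triple_space: "space triple_space = range (\<lambda>u. translate u triple_lattice)"
  unfolding triple_space_def space_restrict_space space_configs
  using locally_finite_triple_lattice locally_finite_translate by blast

lemma measurable_translate_triple_space: "translate t \<in> measurable triple_space triple_space"
proof -
  have "translate t \<in> measurable triple_space configs"
    unfolding triple_space_def by (rule measurable_restrict_space1) measurable
  moreover have "translate t \<phi> \<in> range (\<lambda>u. translate u triple_lattice)" if "\<phi> \<in> space triple_space" for \<phi>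
    using that unfolding space_triple_space by (auto simp: translate_translate)
  ultimately show ?thesis
    unfolding triple_space_def[of] by (intro measurable_restrict_space2) (auto simp: triple_space_def)
qed

text \<open>Translating the process by \<open>t\<close> adds \<open>t\<close> to the uniform shift. As the configuration depends on the
  shift only modulo the lattice, its law stays the same.\<close>

lemma stationary_shifted_triples:
  "stationary_point_process (shifted_triples :: 'a::euclidean_space set measure) translate (\<lambda>\<phi>. \<phi>)"
proof -
  let ?U = "uniform_measure lborel (unit_cube :: 'a set)"
  let ?T = "\<lambda>u. translate u (triple_lattice :: 'a set)"
  have prob: "prob_space ?U"
    by (rule prob_space_uniform_measure) (simp_all add: emeasure_unit_cube)
  have T [measurable]: "?T \<in> measurable ?U triple_space"
    using measurable_shifted_triple by (simp add: measurable_def)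
  have sets: "sets (shifted_triples :: 'a set measure) = sets triple_space"
    and space: "space (shifted_triples :: 'a set measure) = space triple_space"
    unfolding shifted_triples_def by simp_all
  interpret prob_space "shifted_triples :: 'a set measure"
    unfolding shifted_triples_def by (rule prob_space.prob_space_distr[OF prob T])
  show ?thesis
  proof
    show theta: "translate t \<in> measurable shifted_triples (shifted_triples :: 'a set measure)" for t
      using measurable_translate_triple_space[of t] by (simp add: measurable_cong_sets[OF sets sets])
    show "translate 0 \<phi> = \<phi>" for \<phi> :: "'a set" by (simp add: translate_def)
    show "translate (s + t) \<phi> = translate s (translate t \<phi>)" for s t and \<phi> :: "'a set"
      by (simp add: translate_translate)
    show "(\<lambda>\<phi>. \<phi>) \<in> measurable shifted_triples (configs :: 'a set measure)"
    proof -
      have "(\<lambda>\<phi>. \<phi>) \<in> measurable triple_space (configs :: 'a set measure)"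
        unfolding triple_space_def by (rule measurable_restrict_space1) simp
      then show ?thesis by (simp add: measurable_cong_sets[OF sets refl])
    qed
    show "distr shifted_triples shifted_triples (translate t) = (shifted_triples :: 'a set measure)" for t
    proof (rule measure_eqI)
      fix A assume "A \<in> sets (distr shifted_triples shifted_triples (translate t :: 'a set \<Rightarrow> 'a set))"
      then have A [measurable]: "A \<in> sets triple_space" by (simp add: sets)
      have T' [measurable]: "?T \<in> measurable borel triple_space" by (rule measurable_shifted_triple)
      have law: "emeasure shifted_triples B = (\<integral>\<^sup>+u. indicator B (?T u) * indicator unit_cube u \<partial>lborel)"
        if [measurable]: "B \<in> sets triple_space" for B
      proof -
        have "emeasure shifted_triples B = (\<integral>\<^sup>+\<phi>. indicator B \<phi> \<partial>shifted_triples)"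
          using that by (simp add: sets)
        also have "\<dots> = (\<integral>\<^sup>+u. indicator B (?T u) \<partial>?U)"
          unfolding shifted_triples_def by (rule nn_integral_distr) measurable
        also have "\<dots> = (\<integral>\<^sup>+u. indicator B (?T u) * indicator unit_cube u \<partial>lborel)"
          by (subst nn_integral_uniform_measure) (simp_all add: emeasure_unit_cube divide_ennreal_def)
        finally show ?thesis .
      qed
      have pre: "translate t -` A \<inter> space triple_space \<in> sets triple_space"
        using measurable_translate_triple_space A by (rule measurable_sets)
      have "emeasure (distr shifted_triples shifted_triples (translate t)) A =
          emeasure shifted_triples (translate t -` A \<inter> space triple_space)"
        using A by (subst emeasure_distr[OF theta]) (simp_all add: sets space)
      also have "\<dots> = (\<integral>\<^sup>+u. indicator A (?T (u + t)) * indicator unit_cube u \<partial>lborel)"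
        unfolding law[OF pre]
        by (intro nn_integral_cong)
          (auto simp: indicator_def translate_translate add.commute space_triple_space)
      also have "\<dots> = emeasure shifted_triples A"
        unfolding law[OF A]
        by (rule nn_integral_unit_cube_periodic) (simp_all add: translate_triple_lattice)
      finally show "emeasure (distr shifted_triples shifted_triples (translate t)) A =
          emeasure shifted_triples A" .
    qed simp
  qed simp
qed

text \<open>After reduction of the shift modulo the lattice, all points counted in the unit cube come from a fixed
  bounded region of the unshifted configuration. On the other hand, each unit cube contains a lattice
  point.\<close>

lemma shifted_triples_intensity:
  "0 < intensity shifted_triples (\<lambda>\<phi> :: 'a::euclidean_space set. \<phi>)"
  "intensity shifted_triples (\<lambda>\<phi> :: 'a set. \<phi>) < \<infinity>"
proof -
  interpret stationary_point_process "shifted_triples :: 'a set measure" translate "\<lambda>\<phi>. \<phi>"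
    by (rule stationary_shifted_triples)
  have space: "space (shifted_triples :: 'a set measure) = range (\<lambda>u. translate u triple_lattice)"
    unfolding shifted_triples_def by (simp add: space_triple_space)
  define S :: "'a set" where "S = triple_lattice \<inter> cbox 0 (2 *\<^sub>R One)"
  have fin: "finite S"
    using locally_finite_triple_lattice[where 'a = 'a] bounded_cbox
    unfolding S_def locally_finite_config_def by blast
  have upper: "num_points \<phi> (cbox 0 One) \<le> of_nat (card S)" if \<phi>: "\<phi> \<in> space shifted_triples" for \<phi> :: "'a set"
  proof -
    obtain u where "\<phi> = translate u triple_lattice" using \<phi> space by blast
    moreover obtain z where z: "z \<in> lattice" "u - z \<in> unit_cube" using ex1_lattice_shift by blast
    ultimately have \<phi>_eq: "\<phi> = translate (u - z) triple_lattice"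
      using translate_triple_lattice[OF z(1), of "u - z"] by simp
    have "num_points \<phi> (cbox 0 One) = emeasure (count_space UNIV) (triple_lattice \<inter> (\<lambda>x. x + (u - z)) ` cbox 0 One)"
      using num_points_translate[of "u - z" triple_lattice "cbox 0 One"]
      by (simp only: \<phi>_eq num_points_def)
    also have "\<dots> \<le> emeasure (count_space UNIV) S"
    proof (rule emeasure_mono)
      have "x + (u - z) \<in> cbox 0 (2 *\<^sub>R One)" if "x \<in> cbox 0 One" for x
        unfolding mem_box
      proof
        fix b :: 'a assume b: "b \<in> Basis"
        have "0 \<le> x \<bullet> b" "x \<bullet> b \<le> 1" using that b by (auto simp: mem_box)
        moreover have "0 \<le> (u - z) \<bullet> b" "(u - z) \<bullet> b < 1" using z(2) b by (auto simp: unit_cube_def)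
        ultimately show "0 \<bullet> b \<le> (x + (u - z)) \<bullet> b \<and> (x + (u - z)) \<bullet> b \<le> (2 *\<^sub>R One) \<bullet> b"
          using b by (simp add: inner_add_left)
      qed
      then show "triple_lattice \<inter> (\<lambda>x. x + (u - z)) ` cbox 0 One \<subseteq> S" unfolding S_def by blast
    qed simp
    also have "\<dots> = of_nat (card S)" using fin by simp
    finally show ?thesis .
  qed
  have lower: "1 \<le> num_points \<phi> (cbox 0 One)" if \<phi>: "\<phi> \<in> space shifted_triples" for \<phi> :: "'a set"
  proof -
    obtain u where u: "\<phi> = translate u triple_lattice" using \<phi> space by blast
    obtain z where z: "z \<in> lattice" "- u - z \<in> unit_cube" using ex1_lattice_shift by blast
    have "- z + fifth 0 \<in> triple_lattice"
      using uminus_lattice[OF z(1)] unfolding triple_lattice_def by fastforce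
    then have "- z - u \<in> \<phi>" unfolding u using mem_translate[of "- z" u triple_lattice] by (simp add: fifth_0)
    moreover have "- z - u = - u - z" by simp
    ultimately have "{- u - z} \<subseteq> \<phi> \<inter> cbox 0 One" using z(2) unit_cube_subset by auto
    then have "emeasure (count_space UNIV) {- u - z} \<le> num_points \<phi> (cbox 0 One)"
      unfolding num_points_def by (rule emeasure_mono) simp
    then show ?thesis by simp
  qed
  have "(\<integral>\<^sup>+\<phi>. 1 \<partial>(shifted_triples :: 'a set measure)) \<le> intensity shifted_triples (\<lambda>\<phi> :: 'a set. \<phi>)"
    unfolding intensity_def by (intro nn_integral_mono lower)
  then show "0 < intensity shifted_triples (\<lambda>\<phi> :: 'a set. \<phi>)"
    by (simp add: emeasure_space_1) (metis less_le_trans zero_less_one)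
  have "intensity shifted_triples (\<lambda>\<phi> :: 'a set. \<phi>) \<le> (\<integral>\<^sup>+\<phi>. of_nat (card S) \<partial>(shifted_triples :: 'a set measure))"
    unfolding intensity_def by (intro nn_integral_mono upper)
  also have "\<dots> < \<infinity>" by (simp add: emeasure_space_1 of_nat_less_top)
  finally show "intensity shifted_triples (\<lambda>\<phi> :: 'a set. \<phi>) < \<infinity>" .
qed

theorem proposition35:
  "(\<forall>(M :: 'w measure) (\<theta> :: 'a::euclidean_space \<Rightarrow> 'w \<Rightarrow> 'w) \<Phi> f.
      stationary_point_process M \<theta> \<Phi> \<and> 0 < intensity M \<Phi> \<and> intensity M \<Phi> < \<infinity> \<and> point_map f
      \<longrightarrow> (\<exists>h. point_map h \<and>
             (AE \<omega> in M. foil_stable f h (\<Phi> \<omega>)) \<and>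
             (AE \<omega> in M. foil_dense f h (\<Phi> \<omega>)) \<and>
             (AE \<omega> in M. foil_order_preserving f h (\<Phi> \<omega>))))
   \<and>
   (\<exists>(M :: 'a set measure) (\<theta> :: 'a \<Rightarrow> 'a set \<Rightarrow> 'a set) \<Phi> f h h'.
      stationary_point_process M \<theta> \<Phi> \<and> 0 < intensity M \<Phi> \<and> intensity M \<Phi> < \<infinity> \<and> point_map f \<and>
      (\<forall>g\<in>{h, h'}. point_map g \<and>
         (AE \<omega> in M. foil_stable f g (\<Phi> \<omega>)) \<and>
         (AE \<omega> in M. foil_dense f g (\<Phi> \<omega>)) \<and>
         (AE \<omega> in M. foil_order_preserving f g (\<Phi> \<omega>))) \<and>
      \<not> (AE \<omega> in M. \<forall>x\<in>\<Phi> \<omega>. point_shift h (\<Phi> \<omega>) x = point_shift h' (\<Phi> \<omega>) x))"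
proof (intro conjI allI impI)
  fix M :: "'w measure" and \<theta> :: "'a \<Rightarrow> 'w \<Rightarrow> 'w" and \<Phi> :: "'w \<Rightarrow> 'a set"
    and f :: "'a set \<Rightarrow> 'a"
  assume "stationary_point_process M \<theta> \<Phi> \<and> 0 < intensity M \<Phi> \<and> intensity M \<Phi> < \<infinity> \<and> point_map f"
  then show "\<exists>h. point_map h \<and>
             (AE \<omega> in M. foil_stable f h (\<Phi> \<omega>)) \<and>
             (AE \<omega> in M. foil_dense f h (\<Phi> \<omega>)) \<and>
             (AE \<omega> in M. foil_order_preserving f h (\<Phi> \<omega>))"
    using stationary_point_process.ex_dense_order_preserving_point_shift by blast
next
  interpret stationary_point_process "shifted_triples :: 'a set measure" translate "\<lambda>\<phi>. \<phi>"
    by (rule stationary_shifted_triples)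
  let ?M = "shifted_triples :: 'a set measure"
  let ?f = "jump (-2) (-1) :: 'a set \<Rightarrow> 'a" and ?h = "jump 1 (-2) :: 'a set \<Rightarrow> 'a"
    and ?h' = "jump (-1) 2 :: 'a set \<Rightarrow> 'a"
  have space: "\<exists>u. \<phi> = translate u triple_lattice" if "\<phi> \<in> space ?M" for \<phi>
    using that unfolding shifted_triples_def by (auto simp: space_triple_space)
  have good: "point_map g \<and> (AE \<phi> in ?M. foil_stable ?f g \<phi>) \<and> (AE \<phi> in ?M. foil_dense ?f g \<phi>) \<and>
      (AE \<phi> in ?M. foil_order_preserving ?f g \<phi>)" if "g \<in> {?h, ?h'}" for g
  proof -
    have g: "g = ?h \<or> g = ?h'" using that by simp
    have "foil_stable ?f g \<phi> \<and> foil_dense ?f g \<phi> \<and> foil_order_preserving ?f g \<phi>"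
      if \<phi>: "\<phi> \<in> space ?M" for \<phi>
    proof -
      obtain u where u: "\<phi> = translate u triple_lattice" using space[OF \<phi>] by blast
      show ?thesis
        unfolding u by (rule three_cycle_stable_dense) (rule triple_lattice_jumps[OF _ g], assumption)+
    qed
    then show ?thesis using g point_map_jump by (auto intro!: AE_I2)
  qed
  have "\<not> (AE \<phi> in ?M. \<forall>x\<in>\<phi>. point_shift ?h \<phi> x = point_shift ?h' \<phi> x)" (is "\<not> ?agree")
  proof
    assume "AE \<phi> in ?M. \<forall>x\<in>\<phi>. point_shift ?h \<phi> x = point_shift ?h' \<phi> x"
    then have "AE \<phi> in ?M. False"
      using AE_space
    proof eventually_elim
      case (elim \<phi>)
      obtain u where u: "\<phi> = translate u triple_lattice" using space[OF elim(2)] by blast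
      have "0 + fifth 0 \<in> (triple_lattice :: 'a set)"
        unfolding triple_lattice_def lattice_def by fastforce
      then have "0 + fifth 0 - u \<in> \<phi>" unfolding u mem_translate .
      then show False using elim(1) triple_lattice_jumps(3)[of _ u ?h] unfolding u by blast
    qed
    then show False by simp
  qed
  then show "\<exists>(M :: 'a set measure) (\<theta> :: 'a \<Rightarrow> 'a set \<Rightarrow> 'a set) \<Phi> f h h'.
      stationary_point_process M \<theta> \<Phi> \<and> 0 < intensity M \<Phi> \<and> intensity M \<Phi> < \<infinity> \<and> point_map f \<and>
      (\<forall>g\<in>{h, h'}. point_map g \<and>
         (AE \<omega> in M. foil_stable f g (\<Phi> \<omega>)) \<and>
         (AE \<omega> in M. foil_dense f g (\<Phi> \<omega>)) \<and>
         (AE \<omega> in M. foil_order_preserving f g (\<Phi> \<omega>))) \<and>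
      \<not> (AE \<omega> in M. \<forall>x\<in>\<Phi> \<omega>. point_shift h (\<Phi> \<omega>) x = point_shift h' (\<Phi> \<omega>) x)"
    using stationary_shifted_triples shifted_triples_intensity point_map_jump good by blast
qed

end
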